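(* Let $n$ and $d$ be integers with $n > d \geq 12$. Then the Hilbert scheme $\mathrm{Hilb}^{n}(\mathbb{C}^d)$ of $n$ points in affine $d$-space over $\mathbb{C}$ is reducible.
   Context: The base field is $\mathbb{C}$. $\mathrm{Hilb}^{n}(\mathbb{C}^d)$ is the Hilbert scheme parametrizing the ideals $I \subset \mathbb{C}[x_1,\dots,x_d]$ of colength $n$, i.e. with $\dim_{\mathbb{C}} \mathbb{C}[x_1,\dots,x_d]/I = n$. Reducible means not irreducible as a scheme (equivalently, as a topological space). *)

theory Defs
  imports "HOL-Analysis.Analysis" "HOL-Library.Poly_Mapping"
begin

text \<open>
  Polynomials over the complex numbers in variables indexed by \<open>'v\<close>: finitely supported
  functions on the exponent vectors, with the convolution product of \<^theory>\<open>HOL-Library.Poly_Mapping\<close>.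
  If \<open>'v\<close> is finite with \<open>CARD('v) = d\<close>, this type is the polynomial ring in $d$ variables.
\<close>

type_synonym 'v mpoly = "('v \<Rightarrow>\<^sub>0 nat) \<Rightarrow>\<^sub>0 complex"

definition const_mpoly :: "complex \<Rightarrow> 'v mpoly" where
  "const_mpoly a = Poly_Mapping.single 0 a"

definition eval_mpoly :: "('v \<Rightarrow> complex) \<Rightarrow> 'v mpoly \<Rightarrow> complex" where
  "eval_mpoly x F =
     (\<Sum>m\<in>Poly_Mapping.keys F. Poly_Mapping.lookup F m *
        (\<Prod>v\<in>Poly_Mapping.keys m. x v ^ Poly_Mapping.lookup m v))"

text \<open>The ideals of a commutative ring are its submodules over itself.\<close>

definition is_ideal :: "'a::comm_ring_1 set \<Rightarrow> bool" where
  "is_ideal I \<longleftrightarrow> module.subspace (*) I"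

lemma is_ideal_iff:
  "is_ideal I \<longleftrightarrow> 0 \<in> I \<and> (\<forall>f\<in>I. \<forall>g\<in>I. f + g \<in> I) \<and> (\<forall>f. \<forall>g\<in>I. f * g \<in> I)"
proof -
  interpret module "(*) :: 'a \<Rightarrow> 'a \<Rightarrow> 'a"
    by unfold_locales (simp_all add: algebra_simps)
  show ?thesis
    unfolding is_ideal_def subspace_def by blast
qed

text \<open>
  \<open>expansion_mod I B f c\<close>: modulo \<open>I\<close>, \<open>f\<close> is the linear combination of \<open>B\<close> with coefficients \<open>c\<close>.
  The coefficients are normalised to vanish off \<open>B\<close>, so that uniqueness makes sense.
  \<open>basis_mod I B\<close>: the residue classes of the elements of \<open>B\<close> are pairwise distinct and form a
  finite basis of the complex vector space of polynomials modulo \<open>I\<close>.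
\<close>

definition expansion_mod :: "'v mpoly set \<Rightarrow> 'v mpoly set \<Rightarrow> 'v mpoly \<Rightarrow> ('v mpoly \<Rightarrow> complex) \<Rightarrow> bool" where
  "expansion_mod I B f c \<longleftrightarrow>
     (\<forall>b. b \<notin> B \<longrightarrow> c b = 0) \<and> f - (\<Sum>b\<in>B. const_mpoly (c b) * b) \<in> I"

definition basis_mod :: "'v mpoly set \<Rightarrow> 'v mpoly set \<Rightarrow> bool" where
  "basis_mod I B \<longleftrightarrow> finite B \<and> (\<forall>f. \<exists>!c. expansion_mod I B f c)"

definition has_colength :: "'v mpoly set \<Rightarrow> nat \<Rightarrow> bool" where
  "has_colength I n \<longleftrightarrow> (\<exists>B. card B = n \<and> basis_mod I B)"

definition coeff_mod :: "'v mpoly set \<Rightarrow> 'v mpoly set \<Rightarrow> 'v mpoly \<Rightarrow> 'v mpoly \<Rightarrow> complex" where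
  "coeff_mod I B f = (THE c. expansion_mod I B f c)"

text \<open>
  The Hilbert scheme of \<open>n\<close> points, as the space of its closed points (the ideals of colength \<open>n\<close>)
  with the Zariski topology.

  For a set \<open>B\<close> of \<open>n\<close> polynomials, the ideals \<open>I\<close> for which \<open>B\<close> is a basis modulo \<open>I\<close> form an
  affine open subscheme \<open>U B\<close> of the Hilbert scheme, and these cover it. A point of \<open>U B\<close> over a
  \<open>\<complex>\<close>-algebra \<open>R\<close> is the kernel of an \<open>R\<close>-linear map from the polynomials over \<open>R\<close> onto the free
  module on \<open>B\<close>, and that map is given by the coefficients of the images of all complex
  polynomials \<open>f\<close>; so the coordinate ring of \<open>U B\<close> is generated by the functions
  \<open>I \<mapsto> coeff_mod I B f b\<close>. Hence the sets \<open>hilb_basic_open n B F\<close>, with \<open>F\<close> a polynomial in variables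
  indexed by the pairs \<open>(f, b)\<close>, are exactly the principal open subsets of the charts \<open>U B\<close>,
  and they generate the Zariski topology.
\<close>

definition hilb_basic_open :: "nat \<Rightarrow> 'v mpoly set \<Rightarrow> ('v mpoly \<times> 'v mpoly) mpoly \<Rightarrow> 'v mpoly set set" where
  "hilb_basic_open n B F =
     {I. is_ideal I \<and> card B = n \<and> basis_mod I B \<and>
         eval_mpoly (\<lambda>(f, b). coeff_mod I B f b) F \<noteq> 0}"

definition Hilb :: "nat \<Rightarrow> 'v::finite mpoly set topology" where
  "Hilb n = topology_generated_by {hilb_basic_open n B F | B F. True}"

lemma topspace_Hilb: "topspace (Hilb n) = {I. is_ideal I \<and> has_colength I n}"
proof -
  have eval_1: "eval_mpoly x 1 = 1" for x :: "'a mpoly \<times> 'a mpoly \<Rightarrow> complex"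
    by (simp add: eval_mpoly_def)
  have sub: "hilb_basic_open n B F \<subseteq> hilb_basic_open n B 1" for B :: "'a mpoly set" and F
    by (auto simp: hilb_basic_open_def eval_1)
  have "\<Union> {hilb_basic_open n B F | B F. True} = (\<Union>B :: 'a mpoly set. hilb_basic_open n B 1)"
    using sub by blast
  also have "\<dots> = {I. is_ideal I \<and> has_colength I n}"
    by (auto simp: hilb_basic_open_def has_colength_def eval_1)
  finally show ?thesis
    by (simp add: Hilb_def topology_generated_by_topspace)
qed

definition irreducible_space :: "'a topology \<Rightarrow> bool" where
  "irreducible_space X \<longleftrightarrow>
     topspace X \<noteq> {} \<and>
     (\<forall>Y Z. closedin X Y \<and> closedin X Z \<and> topspace X = Y \<union> Z \<longrightarrow> Y = topspace X \<or> Z = topspace X)"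

end

theory Submission
  imports Defs "Jordan_Normal_Form.Determinant" "HOL-Library.Function_Algebras"
begin

text \<open>
  An irreducible space has no two disjoint nonempty open subsets, so it suffices to find two such
  subsets of the Hilbert scheme. The reason for their existence is a comparison of dimensions.

  For a fixed variable \<open>w\<close>, the ideals modulo which \<open>1, w, \<dots>, w ^ (n - 1)\<close> is a basis form a nonempty
  open set \<open>U\<close>. Such an ideal is determined by the expansions of \<open>w ^ n\<close> and of the other
  variables, that is by \<open>n * d\<close> parameters, in which all further coefficients are polynomials
  (\<open>regular_coords_all\<close>). By Cramer's rule, the coefficients with respect to any other basis \<open>B\<close>
  are rational functions of these parameters with a common denominator (\<open>coords_rational\<close>).

  On the other hand there is a family of ideals with too many parameters. Put \<open>a = d - 4\<close>. A
  local algebra with Hilbert function \<open>(1, a, 4)\<close> is given by a four-dimensional space of quadratic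
  forms, which takes \<open>4 * a * (a + 1) / 2\<close> coefficients; embedding it into \<open>d\<close>-space leaves the
  linear forms vanishing on its tangent space free to move. Together with \<open>m = n - d - 1\<close> further
  points on a curve this gives more than \<open>n * d\<close> parameters as soon as \<open>d \<ge> 12\<close>
  (\<open>card_coord_indices\<close>). For a suitable basis \<open>B\<close>, the variables and
  some powers of the last one, this many coefficient functions can be prescribed arbitrarily on the
  family (\<open>family_attains\<close>). The extra points are described by interpolation, as points on a
  curve through the support of the local algebra. In this way one basis serves all values of the
  parameters, and every coefficient is an explicit expression in them.

  More than \<open>n * d\<close> rational functions of \<open>n * d\<close> parameters satisfy a nontrivial polynomial
  relation \<open>F\<close> (\<open>algebraic_dependence\<close>, by counting monomials). So \<open>F\<close> vanishes on the chosen
  coefficients of all ideals in \<open>U\<close> that have the basis \<open>B\<close>, but not on the whole family. The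
  ideals with basis \<open>B\<close> and \<open>F \<noteq> 0\<close> form the second open set.
\<close>

section \<open>Polynomials and their evaluation\<close>

definition Var :: "'v \<Rightarrow> 'v mpoly" where
  "Var v = Poly_Mapping.single (Poly_Mapping.single v 1) 1"

lemma poly_mapping_sum_single:
  "f = (\<Sum>m\<in>Poly_Mapping.keys f. Poly_Mapping.single m (Poly_Mapping.lookup f m))"
proof (rule poly_mapping_eqI)
  fix k
  have "Poly_Mapping.lookup (\<Sum>m\<in>Poly_Mapping.keys f. Poly_Mapping.single m (Poly_Mapping.lookup f m)) k
      = (\<Sum>m\<in>Poly_Mapping.keys f. if m = k then Poly_Mapping.lookup f m else 0)"
    by (simp add: lookup_sum lookup_single when_def)
  also have "\<dots> = Poly_Mapping.lookup f k"
    by (simp add: sum.delta in_keys_iff)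
  finally show "Poly_Mapping.lookup f k =
    Poly_Mapping.lookup (\<Sum>m\<in>Poly_Mapping.keys f. Poly_Mapping.single m (Poly_Mapping.lookup f m)) k"
    by simp
qed

lemma const_mpoly_add: "const_mpoly (a + b) = const_mpoly a + const_mpoly b"
  and const_mpoly_mult: "const_mpoly (a * b) = const_mpoly a * const_mpoly b"
  and const_mpoly_0 [simp]: "const_mpoly 0 = 0"
  and const_mpoly_1 [simp]: "const_mpoly 1 = 1"
  and const_mpoly_uminus: "const_mpoly (- a) = - const_mpoly a"
  by (simp_all add: const_mpoly_def single_add mult_single single_uminus)

lemma Var_power: "Var v ^ k = Poly_Mapping.single (Poly_Mapping.single v k) 1"
  by (induction k) (auto simp: Var_def mult_single simp flip: single_add)

lemma mpoly_induct [case_names const var add mult]: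
  assumes const: "\<And>a. P (const_mpoly a)"
    and var: "\<And>v. P (Var v)"
    and add: "\<And>f g. P f \<Longrightarrow> P g \<Longrightarrow> P (f + g)"
    and mult: "\<And>f g. P f \<Longrightarrow> P g \<Longrightarrow> P (f * g)"
  shows "P (f :: 'v mpoly)"
proof -
  have pow: "P (Poly_Mapping.single (Poly_Mapping.single v k) 1)" for v :: 'v and k
    unfolding Var_power [symmetric]
  proof (induction k)
    case 0 then show ?case using const[of 1] by simp
  next
    case (Suc k) then show ?case using mult[OF var] by simp
  qed
  have mon: "P (Poly_Mapping.single (\<Sum>v\<in>S. Poly_Mapping.single v (e v)) 1)" if "finite S" for S and e :: "'v \<Rightarrow> nat"
    using that
  proof (induction S)
    case empty then show ?case using const[of 1] by (simp add: const_mpoly_def)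
  next
    case (insert v S)
    then show ?case using mult[OF pow[of v "e v"] insert.IH] by (simp add: mult_single)
  qed
  have single: "P (Poly_Mapping.single m c)" for m c
  proof -
    have "P (const_mpoly c * Poly_Mapping.single m 1)"
      by (rule mult[OF const]) (subst poly_mapping_sum_single[of m], rule mon, simp)
    then show ?thesis by (simp add: const_mpoly_def mult_single)
  qed
  have "P (\<Sum>m\<in>S. Poly_Mapping.single m (Poly_Mapping.lookup f m))" if "finite S" for S
    using that
  proof (induction S)
    case empty then show ?case using const[of 0] by simp
  next
    case (insert v S) then show ?case using add[OF single] by simp
  qed
  then show ?thesis by (subst poly_mapping_sum_single) simp
qed

text \<open>
  Polynomials have to be evaluated at points, at tuples of univariate polynomials and at tuples
  of elements of the ring \<open>axis_jet\<close> below. The map \<open>h\<close> is the structure map of a commutative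
  \<open>\<complex>\<close>-algebra, so that one proof of multiplicativity serves all three.
\<close>

locale complex_algebra =
  fixes h :: "complex \<Rightarrow> 'r::comm_ring_1"
  assumes h_add: "h (a + b) = h a + h b" and h_mult: "h (a * b) = h a * h b" and h_1: "h 1 = 1"
begin

lemma h_0: "h 0 = 0"
  using h_add[of 0 0] by simp

definition mon :: "('v \<Rightarrow> 'r) \<Rightarrow> ('v \<Rightarrow>\<^sub>0 nat) \<Rightarrow> 'r" where
  "mon x m = (\<Prod>v\<in>Poly_Mapping.keys m. x v ^ Poly_Mapping.lookup m v)"

definition ev :: "('v \<Rightarrow> 'r) \<Rightarrow> 'v mpoly \<Rightarrow> 'r" where
  "ev x F = (\<Sum>m\<in>Poly_Mapping.keys F. h (Poly_Mapping.lookup F m) * mon x m)"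

lemma mon_superset:
  assumes "finite S" "Poly_Mapping.keys m \<subseteq> S"
  shows "mon x m = (\<Prod>v\<in>S. x v ^ Poly_Mapping.lookup m v)"
  unfolding mon_def using assms
  by (intro prod.mono_neutral_left) (auto simp: in_keys_iff)

lemma ev_superset:
  assumes "finite S" "Poly_Mapping.keys F \<subseteq> S"
  shows "ev x F = (\<Sum>m\<in>S. h (Poly_Mapping.lookup F m) * mon x m)"
  unfolding ev_def using assms
  by (intro sum.mono_neutral_left) (auto simp: in_keys_iff h_0)

lemma mon_add: "mon x (m + m') = mon x m * mon x m'"
proof -
  let ?S = "Poly_Mapping.keys m \<union> Poly_Mapping.keys m'"
  have "Poly_Mapping.keys (m + m') \<subseteq> ?S" by (rule keys_add)
  then show ?thesis
    by (simp add: mon_superset[of ?S] lookup_add power_add prod.distrib)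
qed

lemma mon_0 [simp]: "mon x 0 = 1"
  by (simp add: mon_def)

lemma ev_single: "ev x (Poly_Mapping.single m c) = h c * mon x m"
  by (simp add: ev_def h_0)

lemma ev_add: "ev x (F + G) = ev x F + ev x G"
proof -
  let ?S = "Poly_Mapping.keys F \<union> Poly_Mapping.keys G"
  have "Poly_Mapping.keys (F + G) \<subseteq> ?S" by (rule keys_add)
  then show ?thesis
    by (simp add: ev_superset[of ?S] lookup_add h_add distrib_right sum.distrib)
qed

lemma ev_0 [simp]: "ev x 0 = 0"
  by (simp add: ev_def)

lemma ev_sum: "ev x (sum f A) = (\<Sum>a\<in>A. ev x (f a))"
  by (induction A rule: infinite_finite_induct) (auto simp: ev_add)

lemma ev_mult: "ev x (F * G) = ev x F * ev x G"
proof -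
  let ?t = "\<lambda>F m. Poly_Mapping.single m (Poly_Mapping.lookup F m)"
  have "F * G = (\<Sum>m\<in>Poly_Mapping.keys F. ?t F m) * (\<Sum>m\<in>Poly_Mapping.keys G. ?t G m)"
    by (simp flip: poly_mapping_sum_single)
  also have "ev x \<dots> = (\<Sum>m\<in>Poly_Mapping.keys F. \<Sum>m'\<in>Poly_Mapping.keys G. ev x (?t F m) * ev x (?t G m'))"
    by (simp add: sum_product ev_sum ev_single mult_single h_mult mon_add mult_ac)
  also have "\<dots> = ev x F * ev x G"
    unfolding ev_single by (simp add: ev_def[of x F] ev_def[of x G] sum_product)
  finally show ?thesis .
qed

lemma ev_const: "ev x (const_mpoly a) = h a"
  by (simp add: const_mpoly_def ev_single)

lemma ev_1 [simp]: "ev x 1 = 1"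
  using ev_const[of x 1] h_1 by simp

lemma ev_Var [simp]: "ev x (Var v) = x v"
  by (simp add: Var_def ev_single h_1 mon_def)

lemma ev_power: "ev x (F ^ k) = ev x F ^ k"
  by (induction k) (auto simp: ev_mult)

end

interpretation cplx: complex_algebra "\<lambda>a::complex. a"
  by unfold_locales auto

lemma eval_mpoly_eq: "eval_mpoly x F = cplx.ev x F"
  by (simp add: eval_mpoly_def cplx.ev_def cplx.mon_def)

section \<open>Coordinates modulo an ideal\<close>

lemma is_idealD:
  assumes "is_ideal I"
  shows "0 \<in> I" "f \<in> I \<Longrightarrow> g \<in> I \<Longrightarrow> f + g \<in> I" "g \<in> I \<Longrightarrow> f * g \<in> I" "f \<in> I \<Longrightarrow> g \<in> I \<Longrightarrow> f - g \<in> I"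
proof -
  show *: "0 \<in> I" "f \<in> I \<Longrightarrow> g \<in> I \<Longrightarrow> f + g \<in> I" "g \<in> I \<Longrightarrow> f * g \<in> I" for f g
    using assms by (auto simp: is_ideal_iff)
  show "f - g \<in> I" if "f \<in> I" "g \<in> I"
    using *(2)[OF that(1) *(3)[of g "-1"]] that by simp
qed

text \<open>
  Indexing a basis of the quotient by \<open>{..<n}\<close> turns the coefficient functions of a chart of the
  Hilbert scheme into coordinate vectors, to which matrices can be applied.
\<close>

definition coord :: "'v mpoly set \<Rightarrow> nat \<Rightarrow> (nat \<Rightarrow> 'v mpoly) \<Rightarrow> 'v mpoly \<Rightarrow> nat \<Rightarrow> complex" where
  "coord I n b f k = coeff_mod I (b ` {..<n}) f (b k)"

locale ideal_with_basis =
  fixes I :: "'v mpoly set" and n :: nat and b :: "nat \<Rightarrow> 'v mpoly"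
  assumes ideal: "is_ideal I"
    and inj: "inj_on b {..<n}"
    and basis: "basis_mod I (b ` {..<n})"
begin

abbreviation crd :: "'v mpoly \<Rightarrow> nat \<Rightarrow> complex" where
  "crd \<equiv> coord I n b"

lemma coord_expansion: "f - (\<Sum>k<n. const_mpoly (crd f k) * b k) \<in> I"
proof -
  have "\<exists>!c. expansion_mod I (b ` {..<n}) f c"
    using basis by (auto simp: basis_mod_def)
  then have "expansion_mod I (b ` {..<n}) f (coeff_mod I (b ` {..<n}) f)"
    unfolding coeff_mod_def by (rule theI')
  then show ?thesis
    by (simp add: expansion_mod_def sum.reindex[OF inj] coord_def)
qed

lemma coord_unique:
  assumes "f - (\<Sum>k<n. const_mpoly (u k) * b k) \<in> I" "k < n"
  shows "crd f k = u k"
proof -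
  define c where "c g = (if g \<in> b ` {..<n} then u (the_inv_into {..<n} b g) else 0)" for g
  have c: "c (b k) = u k" if "k < n" for k
    using that inj by (auto simp: c_def the_inv_into_f_f)
  have "expansion_mod I (b ` {..<n}) f c"
    using assms(1) by (auto simp: expansion_mod_def sum.reindex[OF inj] c) (auto simp: c_def)
  moreover have "\<exists>!c. expansion_mod I (b ` {..<n}) f c"
    using basis by (auto simp: basis_mod_def)
  ultimately have "coeff_mod I (b ` {..<n}) f = c"
    unfolding coeff_mod_def by (simp add: the1_equality)
  then show ?thesis using c assms(2) by (simp add: coord_def)
qed

lemma coord_cong: "f - g \<in> I \<Longrightarrow> k < n \<Longrightarrow> crd f k = crd g k"
  using is_idealD(2)[OF ideal _ coord_expansion[of g], of "f - g"]
  by (intro coord_unique) (auto simp: algebra_simps)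

lemma coord_add: "k < n \<Longrightarrow> crd (f + g) k = crd f k + crd g k"
  using is_idealD(2)[OF ideal coord_expansion[of f] coord_expansion[of g]]
  by (intro coord_unique) (auto simp: const_mpoly_add algebra_simps sum.distrib)

lemma coord_scale: "k < n \<Longrightarrow> crd (const_mpoly a * f) k = a * crd f k"
  using is_idealD(3)[OF ideal coord_expansion[of f], of "const_mpoly a"]
  by (intro coord_unique) (auto simp: const_mpoly_mult algebra_simps sum_distrib_left)

lemma coord_0: "k < n \<Longrightarrow> crd 0 k = 0"
  using coord_scale[of k 0 0] by simp

lemma coord_sum: "k < n \<Longrightarrow> crd (sum g A) k = (\<Sum>x\<in>A. crd (g x) k)"
  by (induction A rule: infinite_finite_induct) (auto simp: coord_add coord_0)

lemma coord_basis: "j < n \<Longrightarrow> k < n \<Longrightarrow> crd (b j) k = (if k = j then 1 else 0)"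
proof (intro coord_unique)
  assume "j < n"
  then have "(\<Sum>k<n. const_mpoly (if k = j then 1 else 0) * b k) = b j"
    by (simp add: if_distrib[of const_mpoly] if_distrib[of "\<lambda>x. x * _"] cong: if_cong)
  then show "b j - (\<Sum>k<n. const_mpoly (if k = j then 1 else 0) * b k) \<in> I"
    using is_idealD(1)[OF ideal] by simp
qed

text \<open>
  Multiplication by \<open>g\<close> is linear on the quotient, so it is determined by the products of \<open>g\<close>
  with the basis.
\<close>

lemma coord_mult:
  assumes "k < n"
  shows "crd (f * g) k = (\<Sum>j<n. crd f j * crd (b j * g) k)"
proof -
  have "f * g - (\<Sum>j<n. const_mpoly (crd f j) * b j) * g \<in> I"
    using is_idealD(3)[OF ideal coord_expansion[of f], of g] by (simp add: algebra_simps)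
  then have "crd (f * g) k = crd ((\<Sum>j<n. const_mpoly (crd f j) * b j) * g) k"
    using assms by (rule coord_cong)
  then show ?thesis
    using assms by (simp add: sum_distrib_right coord_sum coord_scale mult.assoc)
qed

end

text \<open>
  This is how ideals of a given colength are constructed: the quotient by the kernel of
  \<open>\<Lambda>\<close> is identified with \<open>\<complex>\<^sup>n\<close>, so a family dual to the components of \<open>\<Lambda>\<close> is a
  basis of it, and \<open>\<Lambda>\<close> itself gives the coordinates.
\<close>

lemma ideal_with_basis_kernel:
  fixes \<Lambda> :: "'v mpoly \<Rightarrow> nat \<Rightarrow> complex"
  assumes add: "\<And>f g k. k < n \<Longrightarrow> \<Lambda> (f + g) k = \<Lambda> f k + \<Lambda> g k"
    and scale: "\<And>a f k. k < n \<Longrightarrow> \<Lambda> (const_mpoly a * f) k = a * \<Lambda> f k"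
    and mult: "\<And>f g. \<forall>k<n. \<Lambda> g k = 0 \<Longrightarrow> \<forall>k<n. \<Lambda> (f * g) k = 0"
    and dual: "\<And>j k. j < n \<Longrightarrow> k < n \<Longrightarrow> \<Lambda> (b j) k = (if k = j then 1 else 0)"
  defines "I \<equiv> {f. \<forall>k<n. \<Lambda> f k = 0}"
  shows "ideal_with_basis I n b"
    and "k < n \<Longrightarrow> coord I n b f k = \<Lambda> f k"
proof -
  have zero: "\<Lambda> 0 k = 0" if "k < n" for k using scale[OF that, of 0 0] by simp
  have inj: "inj_on b {..<n}"
    using dual by (intro inj_onI) (metis lessThan_iff zero_neq_one)
  have ideal: "is_ideal I"
    using zero mult by (auto simp: is_ideal_iff I_def add)
  have diff: "\<Lambda> (f - g) k = \<Lambda> f k - \<Lambda> g k" if "k < n" for f g k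
    using add[OF that, of f "const_mpoly (-1) * g"] scale[OF that, of "-1" g]
    by (simp add: const_mpoly_uminus)
  have sum: "\<Lambda> (sum F A) k = (\<Sum>x\<in>A. \<Lambda> (F x) k)" if "k < n" for F :: "nat \<Rightarrow> 'v mpoly" and A k
    using that by (induction A rule: infinite_finite_induct) (auto simp: add zero)
  have mem: "f - (\<Sum>j<n. const_mpoly (u j) * b j) \<in> I \<longleftrightarrow> (\<forall>k<n. \<Lambda> f k = u k)" for f u
  proof -
    have "\<Lambda> (\<Sum>j<n. const_mpoly (u j) * b j) k = u k" if "k < n" for k
      using that by (simp add: sum scale dual if_distrib[of "\<lambda>x. _ * x"] cong: if_cong)
    then show ?thesis by (simp add: I_def diff)
  qed
  have "\<exists>!c. expansion_mod I (b ` {..<n}) f c" for f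
  proof -
    define c where "c g = (if g \<in> b ` {..<n} then \<Lambda> f (the_inv_into {..<n} b g) else 0)" for g
    have c: "c (b k) = \<Lambda> f k" if "k < n" for k
      using that inj by (auto simp: c_def the_inv_into_f_f)
    have exp: "expansion_mod I (b ` {..<n}) f c' \<longleftrightarrow>
        (\<forall>g. g \<notin> b ` {..<n} \<longrightarrow> c' g = 0) \<and> (\<forall>k<n. \<Lambda> f k = c' (b k))" for c'
      using mem[of f "\<lambda>k. c' (b k)"] by (simp add: expansion_mod_def sum.reindex[OF inj])
    show ?thesis
    proof (rule ex1I[of _ c])
      show "expansion_mod I (b ` {..<n}) f c"
        unfolding exp using c by (auto simp: c_def)
      fix c' assume *: "expansion_mod I (b ` {..<n}) f c'"
      show "c' = c"
      proof
        fix g show "c' g = c g"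
          using * c unfolding exp by (cases "g \<in> b ` {..<n}") (auto simp: c_def)
      qed
    qed
  qed
  then have "basis_mod I (b ` {..<n})" by (simp add: basis_mod_def)
  with ideal inj show *: "ideal_with_basis I n b" by unfold_locales
  interpret ideal_with_basis I n b by fact
  show "coord I n b f k = \<Lambda> f k" if "k < n"
    using coord_unique[of f "\<Lambda> f" k] that mem[of f "\<Lambda> f"] by simp
qed

section \<open>Algebraic dependence by counting monomials\<close>

lemma (in vector_space) dependent_family:
  assumes "finite E" "finite T" "card T < card E" "\<And>s. s \<in> E \<Longrightarrow> g s \<in> span T"
  obtains a where "\<exists>s\<in>E. a s \<noteq> 0" "(\<Sum>s\<in>E. scale (a s) (g s)) = 0"
proof (cases "inj_on g E")
  case True
  have "\<not> independent (g ` E)"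
    using independent_span_bound[of T "g ` E"] assms card_image[OF True] by auto
  then obtain u where u: "\<exists>v\<in>g ` E. u v \<noteq> 0" "(\<Sum>v\<in>g ` E. scale (u v) v) = 0"
    using assms(1) by (auto simp: dependent_finite)
  show ?thesis
    by (rule that[of "\<lambda>s. u (g s)"]) (use u in \<open>auto simp: sum.reindex[OF True]\<close>)
next
  case False
  then obtain s s' where s: "s \<in> E" "s' \<in> E" "s \<noteq> s'" "g s = g s'"
    by (auto simp: inj_on_def)
  define a :: "_ \<Rightarrow> 'a" where "a t = (if t = s then 1 else if t = s' then -1 else 0)" for t
  have "(\<Sum>t\<in>E. scale (a t) (g t)) = (\<Sum>t\<in>{s, s'}. scale (a t) (g t))"
    using s assms(1) by (intro sum.mono_neutral_right) (auto simp: a_def)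
  also have "\<dots> = 0" using s by (simp add: a_def)
  finally show ?thesis
    by (intro that[of a]) (use s in \<open>auto simp: a_def\<close>)
qed

text \<open>
  Polynomial functions of the variables indexed by \<open>S\<close>. As a predicate on functions it is
  closed under the substitutions made below without any bookkeeping of coefficients.
\<close>

inductive polyfun :: "'i set \<Rightarrow> (('i \<Rightarrow> complex) \<Rightarrow> complex) \<Rightarrow> bool" for S where
  const: "polyfun S (\<lambda>_. c)"
| var: "i \<in> S \<Longrightarrow> polyfun S (\<lambda>x. x i)"
| add: "polyfun S f \<Longrightarrow> polyfun S g \<Longrightarrow> polyfun S (\<lambda>x. f x + g x)"
| mult: "polyfun S f \<Longrightarrow> polyfun S g \<Longrightarrow> polyfun S (\<lambda>x. f x * g x)"

lemma polyfun_sum: "(\<And>a. a \<in> A \<Longrightarrow> polyfun S (f a)) \<Longrightarrow> polyfun S (\<lambda>x. \<Sum>a\<in>A. f a x)"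
  by (induction A rule: infinite_finite_induct) (auto intro: polyfun.intros)

lemma polyfun_prod: "(\<And>a. a \<in> A \<Longrightarrow> polyfun S (f a)) \<Longrightarrow> polyfun S (\<lambda>x. \<Prod>a\<in>A. f a x)"
  by (induction A rule: infinite_finite_induct) (auto intro: polyfun.intros)

lemma polyfun_power: "polyfun S f \<Longrightarrow> polyfun S (\<lambda>x. f x ^ k)"
  by (induction k) (auto intro: polyfun.intros)

lemma polyfun_eval_mpoly:
  assumes "polyfun S f"
  shows "\<exists>F. \<forall>x. eval_mpoly x F = f (\<lambda>i. x (g i))"
  using assms
proof induction
  case (const c)
  show ?case by (rule exI[of _ "const_mpoly c"]) (simp add: eval_mpoly_eq cplx.ev_const)
next
  case (var i)
  show ?case by (rule exI[of _ "Var (g i)"]) (simp add: eval_mpoly_eq)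
next
  case (add f h)
  then obtain F H where "\<forall>x. eval_mpoly x F = f (\<lambda>i. x (g i))" "\<forall>x. eval_mpoly x H = h (\<lambda>i. x (g i))"
    by blast
  then show ?case by (intro exI[of _ "F + H"]) (simp add: eval_mpoly_eq cplx.ev_add)
next
  case (mult f h)
  then obtain F H where "\<forall>x. eval_mpoly x F = f (\<lambda>i. x (g i))" "\<forall>x. eval_mpoly x H = h (\<lambda>i. x (g i))"
    by blast
  then show ?case by (intro exI[of _ "F * H"]) (simp add: eval_mpoly_eq cplx.ev_mult)
qed

definition fscale :: "complex \<Rightarrow> ('a \<Rightarrow> complex) \<Rightarrow> 'a \<Rightarrow> complex" where
  "fscale c f = (\<lambda>x. c * f x)"

interpretation fs: vector_space fscale
  by unfold_locales (auto simp: fscale_def algebra_simps)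

text \<open>
  Degrees are bounded in each variable separately: the exponent vectors then form a box, which is
  easy to count.
\<close>

definition monomials :: "'i set \<Rightarrow> nat \<Rightarrow> (('i \<Rightarrow> complex) \<Rightarrow> complex) set" where
  "monomials S r = (\<lambda>t x. \<Prod>i\<in>S. x i ^ t i) ` (PiE S (\<lambda>_. {..r}))"

lemma finite_monomials: "finite S \<Longrightarrow> finite (monomials S r)"
  by (simp add: monomials_def finite_PiE)

lemma card_monomials: "finite S \<Longrightarrow> card (monomials S r) \<le> (r + 1) ^ card S"
  unfolding monomials_def using card_image_le[of "PiE S (\<lambda>_. {..r})"] by (simp add: finite_PiE card_PiE)

lemma monomials_I: "(\<And>i. i \<in> S \<Longrightarrow> t i \<le> r) \<Longrightarrow> (\<lambda>x. \<Prod>i\<in>S. x i ^ t i) \<in> monomials S r"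
  unfolding monomials_def by (rule image_eqI[of _ _ "restrict t S"]) (auto intro: prod.cong)

lemma monomials_mono: "r \<le> r' \<Longrightarrow> monomials S r \<subseteq> monomials S r'"
  unfolding monomials_def by (intro image_mono PiE_mono) auto

lemma span_monomials_mono: "r \<le> r' \<Longrightarrow> f \<in> fs.span (monomials S r) \<Longrightarrow> f \<in> fs.span (monomials S r')"
  using fs.span_mono[OF monomials_mono] by blast

lemma span_monomials_mult:
  assumes "f \<in> fs.span (monomials S r)" "g \<in> fs.span (monomials S r')"
  shows "(\<lambda>x. f x * g x) \<in> fs.span (monomials S (r + r'))"
proof -
  let ?V = "fs.span (monomials S (r + r'))"
  have 1: "(\<lambda>x. (\<Prod>i\<in>S. x i ^ t i) * g x) \<in> ?V" if t: "t \<in> PiE S (\<lambda>_. {..r})" for t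
    using assms(2)
  proof (induction rule: fs.span_induct_alt)
    case base
    then show ?case using fs.span_zero[of "monomials S (r + r')"] by (simp add: zero_fun_def)
  next
    case (step c u v)
    then obtain t' where t': "t' \<in> PiE S (\<lambda>_. {..r'})" and u: "u = (\<lambda>x. \<Prod>i\<in>S. x i ^ t' i)"
      by (auto simp: monomials_def)
    have "(\<lambda>x. \<Prod>i\<in>S. x i ^ (t i + t' i)) \<in> monomials S (r + r')"
      using t t' by (intro monomials_I add_mono) (auto simp: PiE_iff)
    then have "fscale c (\<lambda>x. \<Prod>i\<in>S. x i ^ (t i + t' i)) + (\<lambda>x. (\<Prod>i\<in>S. x i ^ t i) * v x) \<in> ?V"
      using step by (intro fs.span_add fs.span_scale) (auto intro: fs.span_base)
    also have "fscale c (\<lambda>x. \<Prod>i\<in>S. x i ^ (t i + t' i)) + (\<lambda>x. (\<Prod>i\<in>S. x i ^ t i) * v x)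
        = (\<lambda>x. (\<Prod>i\<in>S. x i ^ t i) * (fscale c u + v) x)"
      by (auto simp: fscale_def u power_add prod.distrib algebra_simps fun_eq_iff)
    finally show ?case .
  qed
  show ?thesis
    using assms(1)
  proof (induction rule: fs.span_induct_alt)
    case base
    then show ?case using fs.span_zero[of "monomials S (r + r')"] by (simp add: zero_fun_def)
  next
    case (step c u v)
    then obtain t where t: "t \<in> PiE S (\<lambda>_. {..r})" and u: "u = (\<lambda>x. \<Prod>i\<in>S. x i ^ t i)"
      by (auto simp: monomials_def)
    have "fscale c (\<lambda>x. u x * g x) + (\<lambda>x. v x * g x) \<in> ?V"
      unfolding u using step 1[OF t] by (intro fs.span_add fs.span_scale)
    also have "fscale c (\<lambda>x. u x * g x) + (\<lambda>x. v x * g x) = (\<lambda>x. (fscale c u + v) x * g x)"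
      by (auto simp: fscale_def algebra_simps fun_eq_iff)
    finally show ?case .
  qed
qed

lemma one_in_span_monomials: "(\<lambda>x. 1) \<in> fs.span (monomials S r)"
  using fs.span_base[OF monomials_I[of S "\<lambda>_. 0" r]] by simp

lemma span_monomials_power:
  "f \<in> fs.span (monomials S r) \<Longrightarrow> (\<lambda>x. f x ^ k) \<in> fs.span (monomials S (k * r))"
  by (induction k) (auto simp: one_in_span_monomials intro: span_monomials_mult)

lemma span_monomials_prod:
  "finite A \<Longrightarrow> (\<And>a. a \<in> A \<Longrightarrow> f a \<in> fs.span (monomials S r)) \<Longrightarrow>
   (\<lambda>x. \<Prod>a\<in>A. f a x) \<in> fs.span (monomials S (card A * r))"
  by (induction A rule: finite_induct) (auto simp: one_in_span_monomials intro: span_monomials_mult)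

lemma polyfun_in_span:
  assumes "polyfun S f" "finite S"
  shows "\<exists>r. f \<in> fs.span (monomials S r)"
  using assms(1)
proof induction
  case (const c)
  have "fscale c (\<lambda>x. 1) \<in> fs.span (monomials S 0)"
    by (intro fs.span_scale one_in_span_monomials)
  also have "fscale c (\<lambda>x. 1) = (\<lambda>x. c)" by (simp add: fscale_def)
  finally show ?case by blast
next
  case (var i)
  have "(\<Prod>j\<in>S. x j ^ (if j = i then 1 else 0)) = x i" for x :: "'a \<Rightarrow> complex"
    using var assms(2) prod.remove[of S i "\<lambda>j. x j ^ (if j = i then 1 else 0)"] by simp
  moreover have "(\<lambda>x. \<Prod>j\<in>S. x j ^ (if j = i then 1 else 0)) \<in> fs.span (monomials S 1)"
    by (intro fs.span_base monomials_I) simp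
  ultimately show ?case by auto
next
  case (add f g)
  then obtain r r' where "f \<in> fs.span (monomials S r)" "g \<in> fs.span (monomials S r')" by blast
  then have "f + g \<in> fs.span (monomials S (r + r'))"
    by (intro fs.span_add) (auto intro: span_monomials_mono[rotated])
  then show ?case by (auto simp: plus_fun_def)
next
  case (mult f g)
  then show ?case using span_monomials_mult by blast
qed

text \<open>
  Kronecker substitution: replacing the \<open>i\<close>-th variable by the power \<open>K ^ i\<close> of a
  single one separates all monomials with exponents below \<open>K\<close>, because base \<open>K\<close> digits are
  unique. A nonzero polynomial in several variables thus becomes a nonzero univariate one, which
  has a non-root.
\<close>

lemma digits_bound:
  fixes s :: "nat \<Rightarrow> nat"
  assumes "\<forall>i<N. s i < K"
  shows "(\<Sum>i<N. s i * K ^ i) < K ^ N"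
  using assms
proof (induction N)
  case (Suc N)
  have "(\<Sum>i<Suc N. s i * K ^ i) < (s N + 1) * K ^ N" using Suc by simp
  also have "\<dots> \<le> K * K ^ N" using Suc.prems by (intro mult_right_mono) auto
  finally show ?case by simp
qed simp

lemma digits_inj:
  fixes s t :: "nat \<Rightarrow> nat"
  assumes "\<forall>i<N. s i < K" "\<forall>i<N. t i < K" "(\<Sum>i<N. s i * K ^ i) = (\<Sum>i<N. t i * K ^ i)"
  shows "\<forall>i<N. s i = t i"
  using assms
proof (induction N)
  case (Suc N)
  let ?f = "\<lambda>s. \<Sum>i<N. s i * K ^ i"
  have lt: "?f s < K ^ N" "?f t < K ^ N" using Suc.prems by (auto intro: digits_bound)
  have eq: "?f s + s N * K ^ N = ?f t + t N * K ^ N" using Suc.prems by simp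
  have top: "(x + y * K ^ N) div K ^ N = y" if "x < K ^ N" for x y
  proof -
    have "K ^ N \<noteq> 0" using that by linarith
    from div_mult_self1[OF this, of x y] that show ?thesis by (simp only: div_less add_0_right)
  qed
  have "s N = t N" using top[OF lt(1)] top[OF lt(2)] eq by metis
  with eq have f_eq: "?f s = ?f t" by (simp only: add_right_cancel)
  have "\<forall>i<N. s i = t i"
    by (rule Suc.IH) (use Suc.prems(1,2) f_eq in auto)
  with \<open>s N = t N\<close> show ?case by (simp add: less_Suc_eq)
qed simp

lemma nonzero_value:
  fixes a :: "('e \<Rightarrow> nat) \<Rightarrow> complex"
  assumes "finite J" "s0 \<in> PiE J (\<lambda>_. {..<K})" "a s0 \<noteq> 0"
  shows "\<exists>x. (\<Sum>s\<in>PiE J (\<lambda>_. {..<K}). a s * (\<Prod>e\<in>J. x e ^ s e)) \<noteq> 0"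
proof -
  let ?E = "PiE J (\<lambda>_. {..<K})"
  obtain \<iota> where \<iota>: "bij_betw \<iota> {..<card J} J"
    using assms(1) ex_bij_betw_nat_finite[of J] by (auto simp: atLeast0LessThan)
  define code where "code s = (\<Sum>i<card J. s (\<iota> i) * K ^ i)" for s
  have \<iota>J: "\<iota> i \<in> J" if "i < card J" for i using \<iota> that by (auto simp: bij_betw_def)
  have inj: "s = t" if st: "s \<in> ?E" "t \<in> ?E" "code s = code t" for s t
  proof (rule PiE_ext[OF st(1,2)])
    fix e assume "e \<in> J"
    then obtain i where i: "i < card J" "e = \<iota> i" using \<iota> by (auto simp: bij_betw_def)
    have "\<forall>i<card J. s (\<iota> i) = t (\<iota> i)"
      by (rule digits_inj[of _ _ K]) (use st \<iota>J in \<open>auto simp: code_def PiE_iff\<close>)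
    then show "s e = t e" using i by simp
  qed
  define p where "p = (\<Sum>s\<in>?E. Polynomial.monom (a s) (code s))"
  have fin: "finite ?E" using assms(1) by (simp add: finite_PiE)
  have "coeff p (code s0) = (\<Sum>s\<in>?E. if s = s0 then a s else 0)"
    unfolding p_def coeff_sum using inj assms(2) by (intro sum.cong) auto
  also have "\<dots> = a s0" using fin assms(2) by simp
  finally have "p \<noteq> 0" using assms(3) by auto
  then obtain \<tau> where \<tau>: "poly p \<tau> \<noteq> 0" using poly_all_0_iff_0 by blast
  define x where "x e = \<tau> ^ (K ^ the_inv_into {..<card J} \<iota> e)" for e
  have "(\<Prod>e\<in>J. x e ^ s e) = \<tau> ^ code s" for s
  proof -
    have "(\<Prod>e\<in>J. x e ^ s e) = (\<Prod>i<card J. x (\<iota> i) ^ s (\<iota> i))"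
      using prod.reindex_bij_betw[OF \<iota>, of "\<lambda>e. x e ^ s e"] by simp
    also have "\<dots> = (\<Prod>i<card J. \<tau> ^ (s (\<iota> i) * K ^ i))"
      using \<iota> by (intro prod.cong) (auto simp: x_def the_inv_into_f_f bij_betw_def mult.commute simp flip: power_mult)
    also have "\<dots> = \<tau> ^ code s" by (simp add: code_def power_sum)
    finally show ?thesis .
  qed
  then have "(\<Sum>s\<in>?E. a s * (\<Prod>e\<in>J. x e ^ s e)) = poly p \<tau>"
    by (simp add: p_def poly_sum poly_monom)
  with \<tau> show ?thesis by metis
qed

text \<open>
  The right-hand side will count monomials in \<open>N\<close> quantities, and the left-hand side will bound the
  dimension of a space that contains them. The latter grows with \<open>K\<close> like \<open>K ^ M\<close>, with a
  constant that does not depend on \<open>K\<close>.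
\<close>

lemma count_bound:
  fixes M N r K :: nat
  assumes "M < N" "K > (N * r + 1) ^ M"
  shows "(N * (K * r) + 1) ^ M < K ^ N"
proof -
  have "K \<ge> 1" using assms(2) by simp
  then have "N * (K * r) + 1 \<le> K * (N * r + 1)" by (simp add: algebra_simps)
  then have "(N * (K * r) + 1) ^ M \<le> (K * (N * r + 1)) ^ M" by (rule power_mono) simp
  also have "\<dots> = K ^ M * (N * r + 1) ^ M" by (rule power_mult_distrib)
  also have "\<dots> < K ^ M * K" using assms(2) \<open>K \<ge> 1\<close> by simp
  also have "\<dots> = K ^ Suc M" by simp
  also have "\<dots> \<le> K ^ N" using assms(1) \<open>K \<ge> 1\<close> by (intro power_increasing) auto
  finally show ?thesis .
qed

text \<open>
  More than \<open>card S\<close> rational functions \<open>P e / D\<close> of \<open>card S\<close> parameters satisfy a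
  polynomial relation. To see this, clear denominators in the \<open>K ^ card J\<close> monomials in the
  \<open>P e / D\<close> with exponents below \<open>K\<close>: the results are polynomials in the parameters of degree
  \<open>O(K)\<close>, hence lie in a space of dimension \<open>O(K ^ card S)\<close>, and are linearly dependent
  for large \<open>K\<close>.
\<close>

lemma algebraic_dependence:
  fixes P :: "'e \<Rightarrow> ('i \<Rightarrow> complex) \<Rightarrow> complex"
  assumes S: "finite S" and J: "finite J" and card: "card S < card J"
    and P: "\<And>e. e \<in> J \<Longrightarrow> polyfun S (P e)" and D: "polyfun S D"
  shows "\<exists>F. polyfun J F \<and> (\<exists>x. F x \<noteq> 0) \<and> (\<forall>\<theta> y. D \<theta> \<noteq> 0 \<longrightarrow> (\<forall>e\<in>J. D \<theta> * y e = P e \<theta>) \<longrightarrow> F y = 0)"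
proof -
  have "\<forall>e\<in>J. \<exists>r. P e \<in> fs.span (monomials S r)"
    using polyfun_in_span P S by blast
  then obtain rP where rP: "\<forall>e\<in>J. P e \<in> fs.span (monomials S (rP e))" by metis
  obtain rD where rD: "D \<in> fs.span (monomials S rD)" using polyfun_in_span D S by blast
  define r where "r = rD + (\<Sum>e\<in>J. rP e)"
  have P': "P e \<in> fs.span (monomials S r)" if "e \<in> J" for e
    by (rule span_monomials_mono[of "rP e"])
      (use rP that J member_le_sum[of e J rP] in \<open>auto simp: r_def trans_le_add2\<close>)
  have D': "D \<in> fs.span (monomials S r)"
    by (rule span_monomials_mono[OF _ rD]) (simp add: r_def)
  let ?N = "card J" and ?M = "card S"
  define K where "K = (?N * r + 1) ^ ?M + 1"
  let ?E = "PiE J (\<lambda>_. {..<K})"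
  \<comment> \<open>the monomial with exponents \<open>s\<close> in the quotients, multiplied by \<open>D ^ (K * card J)\<close>\<close>
  define g where "g s = (\<lambda>\<theta>. \<Prod>e\<in>J. P e \<theta> ^ s e * D \<theta> ^ (K - s e))" for s
  have "card (monomials S (?N * (K * r))) \<le> (?N * (K * r) + 1) ^ ?M"
    by (rule card_monomials[OF S])
  also have "\<dots> < K ^ ?N" by (rule count_bound[OF card]) (simp add: K_def)
  also have "\<dots> = card ?E" using J by (simp add: card_PiE)
  finally have lt: "card (monomials S (?N * (K * r))) < card ?E" .
  have g: "g s \<in> fs.span (monomials S (?N * (K * r)))" if s: "s \<in> ?E" for s
    unfolding g_def
  proof (rule span_monomials_prod[OF J])
    fix e assume e: "e \<in> J"
    then have "s e < K" using s by auto
    then have "s e * r + (K - s e) * r = K * r"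
      by (simp flip: add_mult_distrib)
    then show "(\<lambda>\<theta>. P e \<theta> ^ s e * D \<theta> ^ (K - s e)) \<in> fs.span (monomials S (K * r))"
      using span_monomials_mult[OF span_monomials_power[OF P'[OF e], of "s e"] span_monomials_power[OF D', of "K - s e"]]
      by simp
  qed
  obtain a where a: "\<exists>s\<in>?E. a s \<noteq> 0" "(\<Sum>s\<in>?E. fscale (a s) (g s)) = 0"
    by (rule fs.dependent_family[OF _ finite_monomials[OF S] lt g]) (use J in \<open>auto simp: finite_PiE\<close>)
  have rel: "(\<Sum>s\<in>?E. a s * g s \<theta>) = 0" for \<theta>
  proof -
    have "(\<Sum>s\<in>A. fscale (a s) (g s)) \<theta> = (\<Sum>s\<in>A. a s * g s \<theta>)" for A
      by (induction A rule: infinite_finite_induct) (auto simp: fscale_def)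
    then show ?thesis using a(2) by (metis zero_fun_apply)
  qed
  define F where "F x = (\<Sum>s\<in>?E. a s * (\<Prod>e\<in>J. x e ^ s e))" for x
  have poly: "polyfun J F"
    unfolding F_def by (intro polyfun_sum polyfun_prod polyfun_power polyfun.intros)
  have nonzero: "\<exists>x. F x \<noteq> 0"
  proof -
    obtain s where "s \<in> ?E" "a s \<noteq> 0" using a(1) by blast
    then show ?thesis unfolding F_def by (rule nonzero_value[OF J])
  qed
  have vanish: "F y = 0" if D0: "D \<theta> \<noteq> 0" and y: "\<forall>e\<in>J. D \<theta> * y e = P e \<theta>" for \<theta> y
  proof -
    have "g s \<theta> = D \<theta> ^ (K * ?N) * (\<Prod>e\<in>J. y e ^ s e)" if s: "s \<in> ?E" for s
    proof -
      have "P e \<theta> ^ s e * D \<theta> ^ (K - s e) = D \<theta> ^ K * y e ^ s e" if "e \<in> J" for e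
      proof -
        have "s e < K" using s that by auto
        then have "D \<theta> ^ K = D \<theta> ^ s e * D \<theta> ^ (K - s e)" by (simp flip: power_add)
        moreover have "P e \<theta> = D \<theta> * y e" using y that by simp
        ultimately show ?thesis by (simp only: power_mult_distrib mult_ac)
      qed
      then have "g s \<theta> = (\<Prod>e\<in>J. D \<theta> ^ K * y e ^ s e)" by (simp add: g_def)
      then show ?thesis by (simp add: prod.distrib power_mult)
    qed
    then have "0 = (\<Sum>s\<in>?E. a s * (D \<theta> ^ (K * ?N) * (\<Prod>e\<in>J. y e ^ s e)))"
      using rel[of \<theta>] by simp
    also have "\<dots> = D \<theta> ^ (K * ?N) * F y"
      by (simp add: F_def sum_distrib_left mult_ac)
    finally show ?thesis using D0 by simp
  qed
  show ?thesis
    by (intro exI[of _ F] conjI allI impI poly nonzero) (rule vanish)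
qed

section \<open>Ideals with a basis of powers of one variable\<close>

text \<open>
  If the powers \<open>1, w, \<dots>, w ^ (n - 1)\<close> form a basis modulo \<open>I\<close>, then \<open>I\<close> is determined by
  the expansions of \<open>w ^ n\<close> and of the other variables, that is by \<open>n\<close> numbers for every
  variable. So this chart has dimension \<open>n * CARD('v)\<close>; its ideals include those of \<open>n\<close>
  points with distinct \<open>w\<close>-coordinates.
\<close>

locale cyclic_chart =
  fixes n :: nat and w :: "'v::finite"
  assumes n_pos: "n > 0"
begin

abbreviation pw :: "nat \<Rightarrow> 'v mpoly" where "pw k \<equiv> Var w ^ k"

abbreviation cyclic :: "'v mpoly set \<Rightarrow> bool" where "cyclic I \<equiv> ideal_with_basis I n pw"

abbreviation params :: "('v \<times> nat) set" where "params \<equiv> UNIV \<times> {..<n}"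

definition param :: "'v mpoly set \<Rightarrow> 'v \<times> nat \<Rightarrow> complex" where
  "param I = (\<lambda>(v, k). coord I n pw (if v = w then Var w ^ n else Var v) k)"

text \<open>
  Only the values on the chart matter, since \<open>param I\<close> is meaningless elsewhere.
\<close>

definition regular :: "('v mpoly set \<Rightarrow> complex) \<Rightarrow> bool" where
  "regular \<phi> \<longleftrightarrow> (\<exists>R. polyfun params R \<and> (\<forall>I. cyclic I \<longrightarrow> \<phi> I = R (param I)))"

lemma regularI: "polyfun params R \<Longrightarrow> (\<And>I. cyclic I \<Longrightarrow> \<phi> I = R (param I)) \<Longrightarrow> regular \<phi>"
  unfolding regular_def by blast

lemma regular_cong: "regular \<psi> \<Longrightarrow> (\<And>I. cyclic I \<Longrightarrow> \<phi> I = \<psi> I) \<Longrightarrow> regular \<phi>"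
  unfolding regular_def by auto

lemma regular_const: "regular (\<lambda>_. c)"
  by (rule regularI[OF polyfun.const]) simp

lemma regular_param: "k < n \<Longrightarrow> regular (\<lambda>I. param I (v, k))"
  by (rule regularI[OF polyfun.var]) auto

lemma regular_add: "regular \<phi> \<Longrightarrow> regular \<psi> \<Longrightarrow> regular (\<lambda>I. \<phi> I + \<psi> I)"
  unfolding regular_def by (metis (mono_tags, lifting) polyfun.add)

lemma regular_mult: "regular \<phi> \<Longrightarrow> regular \<psi> \<Longrightarrow> regular (\<lambda>I. \<phi> I * \<psi> I)"
  unfolding regular_def by (metis (mono_tags, lifting) polyfun.mult)

lemma regular_sum: "(\<And>a. a \<in> A \<Longrightarrow> regular (f a)) \<Longrightarrow> regular (\<lambda>I. \<Sum>a\<in>A. f a I)"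
  by (induction A rule: infinite_finite_induct) (auto intro: regular_const regular_add)

definition regular_coords :: "'v mpoly \<Rightarrow> bool" where
  "regular_coords f \<longleftrightarrow> (\<forall>k<n. regular (\<lambda>I. coord I n pw f k))"

lemma regular_coords_pw: "j \<le> n \<Longrightarrow> regular_coords (pw j)"
proof (cases "j = n")
  case True
  have "regular (\<lambda>I. coord I n pw (pw n) k)" if "k < n" for k
    by (rule regular_cong[OF regular_param[of k w]]) (use that in \<open>auto simp: param_def\<close>)
  then show ?thesis by (simp add: regular_coords_def True)
next
  case False
  assume "j \<le> n"
  with False have "j < n" by simp
  have "regular (\<lambda>I. coord I n pw (pw j) k)" if "k < n" for k
    by (rule regular_cong[OF regular_const[of "if k = j then 1 else 0"]])
      (use that \<open>j < n\<close> in \<open>auto simp: ideal_with_basis.coord_basis[where b = pw]\<close>)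
  then show ?thesis by (simp add: regular_coords_def)
qed

text \<open>
  The products of \<open>g\<close> with the basis are the rows of the matrix of multiplication by \<open>g\<close>.
\<close>

lemma regular_coords_mult_if:
  assumes f: "regular_coords f" and g: "\<And>j. j < n \<Longrightarrow> regular_coords (pw j * g)"
  shows "regular_coords (f * g)"
proof -
  have "regular (\<lambda>I. coord I n pw (f * g) k)" if k: "k < n" for k
  proof (rule regular_cong)
    show "regular (\<lambda>I. \<Sum>j<n. coord I n pw f j * coord I n pw (pw j * g) k)"
      using f g k by (intro regular_sum regular_mult) (auto simp: regular_coords_def)
  qed (rule ideal_with_basis.coord_mult[OF _ k])
  then show ?thesis by (simp add: regular_coords_def)
qed

lemma regular_coords_mult:
  assumes f: "regular_coords f" and g: "regular_coords g"
  shows "regular_coords (f * g)"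
proof (rule regular_coords_mult_if[OF f])
  have step: "regular_coords (h * Var w)" if "regular_coords h" for h
  proof (rule regular_coords_mult_if[OF that])
    fix j assume "j < n"
    then show "regular_coords (pw j * Var w)"
      using regular_coords_pw[of "Suc j"] by (simp add: mult.commute)
  qed
  show "regular_coords (pw j * g)" for j
  proof (induction j)
    case (Suc j)
    then show ?case using step[of "pw j * g"] by (simp add: mult_ac)
  qed (use g in simp)
qed

text \<open>
  The polynomials with regular coordinates form a subring: multiplication by \<open>w\<close> is given by a
  companion matrix in the parameters, and iterating it gives the products with every
  power of \<open>w\<close>. The variables belong to this subring by the choice of the parameters.
\<close>

lemma regular_coords_all: "regular_coords f"
proof (induction f rule: mpoly_induct)
  case (const a)
  have "regular (\<lambda>I. coord I n pw (const_mpoly a) k)" if k: "k < n" for k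
  proof (rule regular_cong)
    show "regular (\<lambda>I. a * coord I n pw (pw 0) k)"
      using regular_coords_pw[of 0] k by (intro regular_mult regular_const) (auto simp: regular_coords_def)
  next
    fix I assume "cyclic I"
    then interpret ideal_with_basis I n pw .
    show "crd (const_mpoly a) k = a * crd (pw 0) k" using coord_scale[OF k, of a 1] by simp
  qed
  then show ?case by (simp add: regular_coords_def)
next
  case (var v)
  show ?case
  proof (cases "v = w")
    case True
    then show ?thesis using regular_coords_pw[of 1] n_pos by simp
  next
    case False
    have "regular (\<lambda>I. coord I n pw (Var v) k)" if "k < n" for k
      by (rule regular_cong[OF regular_param[of k v]]) (use that False in \<open>auto simp: param_def\<close>)
    then show ?thesis by (simp add: regular_coords_def)
  qed
next
  case (add f g)
  have "regular (\<lambda>I. coord I n pw (f + g) k)" if k: "k < n" for k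
    by (rule regular_cong[OF regular_add])
      (use add k in \<open>auto simp: regular_coords_def ideal_with_basis.coord_add[where b = pw]\<close>)
  then show ?case by (simp add: regular_coords_def)
next
  case (mult f g)
  then show ?case by (rule regular_coords_mult)
qed

end

lemma coord_change_basis:
  assumes "ideal_with_basis I n b" "ideal_with_basis I n b'" "k < n"
  shows "coord I n b' f k = (\<Sum>j<n. coord I n b f j * coord I n b' (b j) k)"
proof -
  interpret b: ideal_with_basis I n b by fact
  interpret b': ideal_with_basis I n b' by fact
  show ?thesis
    using b'.coord_cong[OF b.coord_expansion assms(3), of f] assms(3)
    by (simp add: b'.coord_sum b'.coord_scale)
qed

lemma permutes_lt: "p permutes {0..<n} \<Longrightarrow> i < n \<Longrightarrow> p i < (n::nat)"
  by (metis atLeastLessThan_iff permutes_in_image zero_le)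

lemma polyfun_det:
  assumes "\<And>i j. i < n \<Longrightarrow> j < n \<Longrightarrow> polyfun S (f i j)"
  shows "polyfun S (\<lambda>x. Determinant.det (Matrix.mat n n (\<lambda>(i, j). f i j x)))"
proof -
  have "Determinant.det (Matrix.mat n n (\<lambda>(i, j). f i j x)) =
     (\<Sum>p\<in>{p. p permutes {0..<n}}. signof p * (\<Prod>i\<in>{0..<n}. f i (p i) x))" for x
    by (subst det_def'[of _ n]) (auto intro!: sum.cong prod.cong simp: permutes_lt)
  moreover have "polyfun S (\<lambda>x. \<Sum>p\<in>{p. p permutes {0..<n}}. signof p * (\<Prod>i\<in>{0..<n}. f i (p i) x))"
    by (intro polyfun_sum polyfun.mult polyfun.const polyfun_prod assms) (auto simp: permutes_lt)
  ultimately show ?thesis by simp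
qed

lemma polyfun_adj_mat:
  assumes "\<And>i j. i < n \<Longrightarrow> j < n \<Longrightarrow> polyfun S (f i j)" "k < n" "l < n"
  shows "polyfun S (\<lambda>x. adj_mat (Matrix.mat n n (\<lambda>(i, j). f i j x)) $$ (k, l))"
proof -
  define g where "g i j = f (if i < l then i else Suc i) (if j < k then j else Suc j)" for i j
  have "adj_mat (Matrix.mat n n (\<lambda>(i, j). f i j x)) $$ (k, l) =
     (-1) ^ (l + k) * Determinant.det (Matrix.mat (n - 1) (n - 1) (\<lambda>(i, j). g i j x))" for x
  proof -
    have "mat_delete (Matrix.mat n n (\<lambda>(i, j). f i j x)) l k =
        Matrix.mat (n - 1) (n - 1) (\<lambda>(i, j). g i j x)"
      using assms(2,3) by (intro eq_matI) (auto simp: mat_delete_def g_def)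
    then show ?thesis using assms(2,3) by (simp add: adj_mat_def cofactor_def)
  qed
  moreover have "polyfun S (\<lambda>x. (-1) ^ (l + k) * Determinant.det (Matrix.mat (n - 1) (n - 1) (\<lambda>(i, j). g i j x)))"
    by (intro polyfun.mult polyfun.const polyfun_det) (auto simp: g_def intro!: assms(1))
  ultimately show ?thesis by simp
qed

context cyclic_chart
begin

text \<open>
  Where the cyclic chart meets another chart, the transition matrix \<open>A\<close> has polynomial entries
  in the parameters and is invertible; Cramer's rule makes the coordinates with respect to the other
  basis rational functions with the common denominator \<open>det A\<close>.
\<close>

lemma coords_rational:
  fixes b :: "nat \<Rightarrow> 'v mpoly"
  obtains D where "polyfun params D"
    "\<And>I. cyclic I \<Longrightarrow> ideal_with_basis I n b \<Longrightarrow> D (param I) \<noteq> 0"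
    "\<And>f i. i < n \<Longrightarrow> \<exists>P. polyfun params P \<and> (\<forall>I. cyclic I \<longrightarrow> ideal_with_basis I n b \<longrightarrow>
        D (param I) * coord I n b f i = P (param I))"
proof -
  have "\<exists>R. \<forall>k<n. polyfun params (R k) \<and> (\<forall>I. cyclic I \<longrightarrow> coord I n pw f k = R k (param I))" for f
    using regular_coords_all[of f] unfolding regular_coords_def regular_def by metis
  then obtain R where R: "\<And>f k. k < n \<Longrightarrow> polyfun params (R f k)"
      "\<And>f k I. k < n \<Longrightarrow> cyclic I \<Longrightarrow> coord I n pw f k = R f k (param I)"
    by metis
  define A where "A \<theta> = Matrix.mat n n (\<lambda>(j, k). R (b j) k \<theta>)" for \<theta>
  have A: "A \<theta> \<in> carrier_mat n n" for \<theta> by (simp add: A_def)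
  define D where "D \<theta> = Determinant.det (A \<theta>)" for \<theta>
  show ?thesis
  proof (rule that)
    show "polyfun params D" unfolding D_def A_def by (intro polyfun_det R)
  next
    fix I assume I: "cyclic I" "ideal_with_basis I n b"
    \<comment> \<open>the inverse transition matrix\<close>
    define C where "C = Matrix.mat n n (\<lambda>(k, j). coord I n b (pw k) j)"
    have "A (param I) * C = 1\<^sub>m n"
    proof (rule eq_matI)
      fix i j assume ij: "i < dim_row (1\<^sub>m n :: complex mat)" "j < dim_col (1\<^sub>m n :: complex mat)"
      then have "(A (param I) * C) $$ (i, j) = (\<Sum>k<n. coord I n pw (b i) k * coord I n b (pw k) j)"
        using I by (simp add: A_def C_def scalar_prod_def R(2) atLeast0LessThan)
      also have "\<dots> = coord I n b (b i) j"
        using ij by (subst coord_change_basis[OF I, of j]) auto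
      also have "\<dots> = 1\<^sub>m n $$ (i, j)"
        using ij ideal_with_basis.coord_basis[OF I(2)] by simp
      finally show "(A (param I) * C) $$ (i, j) = 1\<^sub>m n $$ (i, j)" .
    qed (auto simp: A_def C_def)
    then have "D (param I) * Determinant.det C = 1"
      unfolding D_def using Determinant.det_mult[of "A (param I)" n C] by (simp add: A C_def)
    then show "D (param I) \<noteq> 0" by auto
  next
    fix f :: "'v mpoly" and i assume i: "i < n"
    define P where "P \<theta> = (\<Sum>k<n. R f k \<theta> * adj_mat (A \<theta>) $$ (k, i))" for \<theta>
    have "polyfun params P"
      unfolding P_def A_def using i by (intro polyfun_sum polyfun.mult polyfun_adj_mat R) auto
    moreover have "D (param I) * coord I n b f i = P (param I)"
      if I: "cyclic I" "ideal_with_basis I n b" for I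
    proof -
      let ?A = "A (param I)"
      have entry: "(\<Sum>k<n. ?A $$ (j, k) * adj_mat ?A $$ (k, i)) = (if j = i then D (param I) else 0)" if "j < n" for j
      proof -
        have 1: "(?A * adj_mat ?A) $$ (j, i) = (\<Sum>k<n. ?A $$ (j, k) * adj_mat ?A $$ (k, i))"
          using that i adj_mat(1)[OF A, of "param I"] A[of "param I"]
          by (auto simp: scalar_prod_def atLeast0LessThan)
        have 2: "(?A * adj_mat ?A) $$ (j, i) = (if j = i then D (param I) else 0)"
          using that i adj_mat(2)[OF A, of "param I"] by (simp add: D_def)
        show ?thesis by (rule trans[OF 1[symmetric] 2])
      qed
      have change: "coord I n pw f k = (\<Sum>j<n. coord I n b f j * ?A $$ (j, k))" if "k < n" for k
        using coord_change_basis[OF I(2,1) that, of f] that by (simp add: A_def R(2)[OF _ I(1)])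
      have "P (param I) = (\<Sum>k<n. coord I n pw f k * adj_mat ?A $$ (k, i))"
        using I by (simp add: P_def R(2))
      also have "\<dots> = (\<Sum>k<n. (\<Sum>j<n. coord I n b f j * ?A $$ (j, k)) * adj_mat ?A $$ (k, i))"
        by (intro sum.cong refl) (simp add: change)
      also have "\<dots> = (\<Sum>j<n. coord I n b f j * (\<Sum>k<n. ?A $$ (j, k) * adj_mat ?A $$ (k, i)))"
        by (simp add: sum_distrib_left sum_distrib_right mult.assoc) (rule sum.swap)
      also have "\<dots> = (\<Sum>j<n. coord I n b f j * (if j = i then D (param I) else 0))"
        by (intro sum.cong refl) (simp add: entry)
      also have "\<dots> = D (param I) * coord I n b f i"
        using i by (simp add: if_distrib[of "\<lambda>x. _ * x"] cong: if_cong)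
      finally show ?thesis by simp
    qed
    ultimately show "\<exists>P. polyfun params P \<and> (\<forall>I. cyclic I \<longrightarrow> ideal_with_basis I n b \<longrightarrow>
        D (param I) * coord I n b f i = P (param I))" by blast
  qed
qed

end

section \<open>Existence of cyclic ideals\<close>

(* smult is to denote the scalar multiple of a polynomial *)
hide_const (open) Module.module.smult

interpretation polyalg: complex_algebra "\<lambda>c::complex. [:c:]"
  by unfold_locales (auto simp: one_pCons)

lemma X_power: "[:0, 1:] ^ k = (monom 1 k :: complex poly)"
  by (simp add: monom_altdef)

context cyclic_chart
begin

text \<open>
  The monomial ideal generated by \<open>w ^ n\<close> and the other variables.
\<close>

lemma cyclic_exists: "\<exists>I. cyclic I"
proof -
  define x :: "'v \<Rightarrow> complex poly" where "x v = (if v = w then [:0, 1:] else 0)" for v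
  define \<Lambda> where "\<Lambda> f k = coeff (polyalg.ev x f) k" for f k
  have "ideal_with_basis {f. \<forall>k<n. \<Lambda> f k = 0} n pw"
  proof (rule ideal_with_basis_kernel)
    fix f g assume "\<forall>k<n. \<Lambda> g k = 0"
    then show "\<forall>k<n. \<Lambda> (f * g) k = 0"
      by (auto simp: \<Lambda>_def polyalg.ev_mult coeff_mult intro!: sum.neutral)
  qed (auto simp: \<Lambda>_def polyalg.ev_mult polyalg.ev_add polyalg.ev_const polyalg.ev_power x_def X_power)
  then show ?thesis by blast
qed

end

section \<open>Functions on a line with a thickened origin\<close>

text \<open>
  The functions on the union of a line with coordinate \<open>z\<close> and the second infinitesimal
  neighbourhood of the origin in a space with coordinates \<open>\<xi>\<^sub>0, \<xi>\<^sub>1, \<dots>\<close> transversal to it: a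
  polynomial in \<open>z\<close>, the linear terms, and the matrix of second derivatives of the quadratic
  terms. The relations are \<open>z \<xi>\<^sub>i = 0\<close> and \<open>\<xi>\<^sub>i \<xi>\<^sub>j \<xi>\<^sub>k = 0\<close>; therefore a polynomial in \<open>z\<close> acts on
  the transversal terms by its constant coefficient.
\<close>

datatype axis_jet = Axis_Jet
  (axis_part: "complex poly") (lin_part: "nat \<Rightarrow> complex") (quad_part: "nat \<Rightarrow> nat \<Rightarrow> complex")

instantiation axis_jet :: comm_ring_1
begin

definition "0 = Axis_Jet 0 (\<lambda>_. 0) (\<lambda>_ _. 0)"
definition "1 = Axis_Jet 1 (\<lambda>_. 0) (\<lambda>_ _. 0)"
definition "x + y = Axis_Jet (axis_part x + axis_part y)
  (\<lambda>i. lin_part x i + lin_part y i) (\<lambda>i j. quad_part x i j + quad_part y i j)"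
definition "- x = Axis_Jet (- axis_part x) (\<lambda>i. - lin_part x i) (\<lambda>i j. - quad_part x i j)"
definition "x - y = Axis_Jet (axis_part x - axis_part y)
  (\<lambda>i. lin_part x i - lin_part y i) (\<lambda>i j. quad_part x i j - quad_part y i j)"
definition "x * y = Axis_Jet (axis_part x * axis_part y)
  (\<lambda>i. coeff (axis_part x) 0 * lin_part y i + coeff (axis_part y) 0 * lin_part x i)
  (\<lambda>i j. coeff (axis_part x) 0 * quad_part y i j + coeff (axis_part y) 0 * quad_part x i j +
      (lin_part x i * lin_part y j + lin_part x j * lin_part y i))"

instance
proof
  fix x y z :: axis_jet
  show "x * y * z = x * (y * z)"
    by (simp add: times_axis_jet_def coeff_mult_0 fun_eq_iff algebra_simps)
  show "x * y = y * x" "(x + y) * z = x * z + y * z" "1 * x = x" "0 + x = x" "x + y + z = x + (y + z)"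
    "x + y = y + x" "- x + x = 0" "x - y = x + - y"
    by (simp_all add: times_axis_jet_def plus_axis_jet_def one_axis_jet_def zero_axis_jet_def uminus_axis_jet_def
        minus_axis_jet_def coeff_mult_0 fun_eq_iff algebra_simps)
  show "(0::axis_jet) \<noteq> 1"
    by (simp add: one_axis_jet_def zero_axis_jet_def)
qed

end

lemma jet_sel [simp]:
  "axis_part (x + y) = axis_part x + axis_part y" "lin_part (x + y) i = lin_part x i + lin_part y i"
  "quad_part (x + y) i j = quad_part x i j + quad_part y i j"
  "axis_part (x * y) = axis_part x * axis_part y"
  "lin_part (x * y) i = coeff (axis_part x) 0 * lin_part y i + coeff (axis_part y) 0 * lin_part x i"
  "quad_part (x * y) i j = coeff (axis_part x) 0 * quad_part y i j + coeff (axis_part y) 0 * quad_part x i j +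
      (lin_part x i * lin_part y j + lin_part x j * lin_part y i)"
  by (simp_all add: times_axis_jet_def plus_axis_jet_def)

definition jet_const :: "complex \<Rightarrow> axis_jet" where
  "jet_const c = Axis_Jet [:c:] (\<lambda>_. 0) (\<lambda>_ _. 0)"

lemma jet_const_sel [simp]:
  "axis_part (jet_const r) = [:r:]" "lin_part (jet_const r) i = 0" "quad_part (jet_const r) i j = 0"
  by (simp_all add: jet_const_def)

interpretation jetalg: complex_algebra jet_const
  by unfold_locales (auto simp: jet_const_def plus_axis_jet_def times_axis_jet_def one_axis_jet_def one_pCons)

lemma Jet_power: "Axis_Jet q (\<lambda>_. 0) (\<lambda>_ _. 0) ^ k = Axis_Jet (q ^ k) (\<lambda>_. 0) (\<lambda>_ _. 0)"
  by (induction k) (auto simp: one_axis_jet_def times_axis_jet_def)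

section \<open>A family of large dimension\<close>

definition glued_basis :: "nat \<Rightarrow> (nat \<Rightarrow> 'v) \<Rightarrow> nat \<Rightarrow> 'v mpoly" where
  "glued_basis a \<iota> i = (if i < a + 3 then Var (\<iota> i) else Var (\<iota> (a + 3)) ^ (i - (a + 3)))"

text \<open>
  If \<open>p(0) \<noteq> 0\<close> and \<open>c\<close> and \<open>e\<close> are general, the ideals of the family describe a local algebra
  with Hilbert function \<open>(1, a, 4)\<close> supported at the origin, together with \<open>m\<close> points,
  possibly coinciding, on a curve through the origin with coordinate \<open>z\<close>. There are \<open>a + 4\<close> variables \<open>x\<^sub>i = Var (\<iota> i)\<close>, in which
  \<^item> \<open>x\<^sub>0, \<dots>, x\<^sub>a\<^sub>-\<^sub>1\<close> generate the maximal ideal of the local algebra modulo its square,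
  \<^item> \<open>x\<^sub>a, x\<^sub>a\<^sub>+\<^sub>1, x\<^sub>a\<^sub>+\<^sub>2\<close> give three of the four dimensions of its socle, up to terms that are
    linear in the first group or lie on the curve,
  \<^item> \<open>z = x\<^sub>a\<^sub>+\<^sub>3\<close> gives the fourth dimension; it satisfies \<open>z ^ 2 * p(z) = 0\<close>, and
    \<open>z * p(z)\<close> lies in the socle.

  In the quotient, the variables other than \<open>z\<close> are \<open>x\<^sub>i = z * h\<^sub>i(z) + \<xi>\<^sub>i\<close> for \<open>i < a\<close> and
  \<open>x\<^sub>a\<^sub>+\<^sub>k = z * h\<^sub>a\<^sub>+\<^sub>k(z) + \<upsilon>\<^sub>k + (\<Sum>l<a. t k l * \<xi>\<^sub>l)\<close> for \<open>k < 3\<close>, where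
  \<open>\<xi>\<^sub>i\<close> and \<open>\<upsilon>\<^sub>k = \<xi>\<^sub>a\<^sub>+\<^sub>k\<close> are killed by \<open>z\<close>, the \<open>\<upsilon>\<^sub>k\<close> are killed by all variables, and
  \<open>\<xi>\<^sub>i * \<xi>\<^sub>j = (\<Sum>k<3. c k i j * \<upsilon>\<^sub>k) + e i j * z * p(z)\<close>. The quotient has dimension \<open>a + m + 5\<close>
  for all values of the parameters \<open>p, h, t, c, e\<close>.
\<close>

locale glued_family =
  fixes a m :: nat and \<iota> :: "nat \<Rightarrow> 'v::finite"
    and p :: "complex poly" and h :: "nat \<Rightarrow> complex poly" and t :: "nat \<Rightarrow> nat \<Rightarrow> complex"
    and c :: "nat \<Rightarrow> nat \<Rightarrow> nat \<Rightarrow> complex" and e :: "nat \<Rightarrow> nat \<Rightarrow> complex"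
  assumes \<iota>: "inj_on \<iota> {..<a + 4}"
    and p: "degree p = m" "lead_coeff p = 1"
    and h: "\<And>i j. j \<ge> m \<Longrightarrow> coeff (h i) j = 0"
    and c_sym: "\<And>k i j. c k i j = c k j i" and e_sym: "\<And>i j. e i j = e j i"
begin

text \<open>
  The functional \<open>\<Lambda>\<^sub>J\<close> below sends an element of \<open>axis_jet\<close> to the coordinates of its class in
  the quotient: first the products \<open>\<xi>\<^sub>i * \<xi>\<^sub>j\<close> are replaced by their values, then \<open>\<beta>\<close> is the
  coefficient of \<open>x\<^sub>a\<^sub>+\<^sub>k\<close>, \<open>\<alpha>\<close> is that of \<open>x\<^sub>l\<close>, and what remains is a polynomial in \<open>z\<close>
  modulo \<open>z ^ 2 * p(z)\<close>. Halving in \<open>quad\<close> compensates for the matrix of second derivatives, in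
  which \<open>\<xi>\<^sub>i * \<xi>\<^sub>j\<close> with \<open>i \<noteq> j\<close> occurs at two places and \<open>\<xi>\<^sub>i * \<xi>\<^sub>i\<close> once with entry \<open>2\<close>.
\<close>

definition quad :: "(nat \<Rightarrow> nat \<Rightarrow> complex) \<Rightarrow> (nat \<Rightarrow> nat \<Rightarrow> complex) \<Rightarrow> complex" where
  "quad g s = (\<Sum>i<a. \<Sum>j<a. g i j * s i j) / 2"

definition \<beta> :: "axis_jet \<Rightarrow> nat \<Rightarrow> complex" where
  "\<beta> T k = lin_part T (a + k) + quad (c k) (quad_part T)"

definition \<alpha> :: "axis_jet \<Rightarrow> nat \<Rightarrow> complex" where
  "\<alpha> T l = lin_part T l - (\<Sum>k<3. \<beta> T k * t k l)"

definition modulus :: "complex poly" where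
  "modulus = pCons 0 (pCons 0 p)"

definition curve_part :: "axis_jet \<Rightarrow> complex poly" where
  "curve_part T = axis_part T + smult (quad e (quad_part T)) (pCons 0 p)
     - pCons 0 ((\<Sum>l<a. smult (\<alpha> T l) (h l)) + (\<Sum>k<3. smult (\<beta> T k) (h (a + k))))"

definition \<Lambda>\<^sub>J :: "axis_jet \<Rightarrow> nat \<Rightarrow> complex" where
  "\<Lambda>\<^sub>J T i = (if i < a then \<alpha> T i else if i < a + 3 then \<beta> T (i - a)
     else coeff (curve_part T mod modulus) (i - (a + 3)))"

text \<open>
  The images of the variables \<open>x\<^sub>i\<close>.
\<close>

definition gen :: "nat \<Rightarrow> axis_jet" where
  "gen i = (if i < a + 3 then Axis_Jet (pCons 0 (h i))
       (\<lambda>l. if l = i then 1 else if a \<le> i \<and> l < a then t (i - a) l else 0) (\<lambda>_ _. 0)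
     else Axis_Jet [:0, 1:] (\<lambda>_. 0) (\<lambda>_ _. 0))"

definition \<phi> :: "'v mpoly \<Rightarrow> axis_jet" where
  "\<phi> = jetalg.ev (\<lambda>v. gen (the_inv_into {..<a + 4} \<iota> v))"

abbreviation basis_elem :: "nat \<Rightarrow> 'v mpoly" where
  "basis_elem \<equiv> glued_basis a \<iota>"

definition member :: "'v mpoly set" where
  "member = {f. \<forall>i<a + m + 5. \<Lambda>\<^sub>J (\<phi> f) i = 0}"

lemma \<phi>_Var: "i < a + 4 \<Longrightarrow> \<phi> (Var (\<iota> i)) = gen i"
  using \<iota> by (simp add: \<phi>_def the_inv_into_f_f)

lemma degree_modulus: "degree modulus = m + 2"
  using p by (auto simp: modulus_def)

lemma coeff_mod_modulus:
  assumes "j < 2"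
  shows "coeff (q mod modulus) j = coeff q j"
proof -
  have "coeff q j = coeff (q div modulus * modulus + q mod modulus) j" by simp
  also have "\<dots> = coeff (q mod modulus) j"
    using assms by (auto simp: modulus_def less_2_cases_iff)
  finally show ?thesis by simp
qed

lemma quad_add: "quad g (\<lambda>i j. s i j + s' i j) = quad g s + quad g s'"
  by (simp add: quad_def distrib_left sum.distrib add_divide_distrib)

lemma quad_scale: "quad g (\<lambda>i j. r * s i j) = r * quad g s"
  by (simp add: quad_def sum_distrib_left mult_ac)

lemma quad_0 [simp]: "quad g (\<lambda>_ _. 0) = 0"
  by (simp add: quad_def)

lemma \<Lambda>\<^sub>J_add: "\<Lambda>\<^sub>J (x + y) i = \<Lambda>\<^sub>J x i + \<Lambda>\<^sub>J y i"
proof -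
  have quad_part: "quad_part (x + y) = (\<lambda>i j. quad_part x i j + quad_part y i j)" by (simp add: fun_eq_iff)
  have \<beta>: "\<beta> (x + y) k = \<beta> x k + \<beta> y k" for k
    by (simp add: \<beta>_def quad_part quad_add)
  have \<alpha>: "\<alpha> (x + y) l = \<alpha> x l + \<alpha> y l" for l
    by (simp add: \<alpha>_def \<beta> algebra_simps sum.distrib)
  have "curve_part (x + y) = curve_part x + curve_part y"
    by (simp add: curve_part_def \<alpha> \<beta> quad_part quad_add smult_add_left sum.distrib algebra_simps)
  then show ?thesis by (simp add: \<Lambda>\<^sub>J_def \<alpha> \<beta> poly_mod_add_left)
qed

lemma \<Lambda>\<^sub>J_scale: "\<Lambda>\<^sub>J (jet_const r * x) i = r * \<Lambda>\<^sub>J x i"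
proof -
  have lin_part: "lin_part (jet_const r * x) i = r * lin_part x i" and axis_part: "axis_part (jet_const r * x) = smult r (axis_part x)"
    and quad_part: "quad_part (jet_const r * x) = (\<lambda>i j. r * quad_part x i j)" for i
    by (simp_all add: fun_eq_iff)
  have \<beta>: "\<beta> (jet_const r * x) k = r * \<beta> x k" for k
    by (simp add: \<beta>_def lin_part quad_part quad_scale distrib_left)
  have \<alpha>: "\<alpha> (jet_const r * x) l = r * \<alpha> x l" for l
    by (simp add: \<alpha>_def \<beta> lin_part right_diff_distrib sum_distrib_left mult.assoc)
  have "smult r (\<Sum>l\<in>A. smult (f l) (g l)) = (\<Sum>l\<in>A. smult (r * f l) (g l))" for f g and A :: "nat set"
    by (induction A rule: infinite_finite_induct) (auto simp: smult_add_right)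
  then have "curve_part (jet_const r * x) = smult r (curve_part x)"
    by (simp add: curve_part_def \<alpha> \<beta> axis_part quad_part quad_scale smult_add_right smult_diff_right)
  then show ?thesis by (simp add: \<Lambda>\<^sub>J_def \<alpha> \<beta> mod_smult_left)
qed

text \<open>
  The kernel of \<open>\<Lambda>\<^sub>J\<close> consists of elements without constant term, and without linear terms in
  the \<open>\<xi>\<^sub>i\<close> with \<open>i < a\<close>. Hence \<open>y\<close> acts on the remaining transversal terms by its constant
  coefficient; on the axis, the rest of \<open>y\<close> contributes a multiple of \<open>z * (z * p(z))\<close>.
\<close>

lemma \<Lambda>\<^sub>J_mult:
  assumes "\<forall>i<a + m + 5. \<Lambda>\<^sub>J x i = 0"
  shows "\<Lambda>\<^sub>J (y * x) i = 0"
proof -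
  have \<beta>0: "\<beta> x k = 0" if "k < 3" for k
    using assms[rule_format, of "a + k"] that by (simp add: \<Lambda>\<^sub>J_def)
  have \<alpha>0: "\<alpha> x l = 0" if "l < a" for l
    using assms[rule_format, of l] that by (simp add: \<Lambda>\<^sub>J_def)
  have v0: "lin_part x l = 0" if "l < a" for l
    using \<alpha>0[OF that] \<beta>0 by (simp add: \<alpha>_def)
  let ?E = "quad e (quad_part x)"
  have cp: "curve_part x = axis_part x + smult ?E (pCons 0 p)"
    using \<alpha>0 \<beta>0 by (simp add: curve_part_def)
  have "curve_part x mod modulus = 0"
  proof (rule poly_eqI)
    fix j
    have "coeff (curve_part x mod modulus) j = 0" if "j \<ge> m + 2"
    proof (rule coeff_eq_0)
      have "modulus \<noteq> 0" using degree_modulus by auto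
      then show "degree (curve_part x mod modulus) < j"
        using degree_mod_less'[of modulus "curve_part x"] degree_modulus that by fastforce
    qed
    moreover have "coeff (curve_part x mod modulus) j = 0" if "j < m + 2"
      using assms[rule_format, of "a + 3 + j"] that by (simp add: \<Lambda>\<^sub>J_def)
    ultimately show "coeff (curve_part x mod modulus) j = coeff 0 j" by fastforce
  qed
  then have dvd: "modulus dvd axis_part x + smult ?E (pCons 0 p)"
    by (simp add: mod_eq_0_iff_dvd cp)
  have q0: "coeff (axis_part x) 0 = 0"
    using coeff_mod_modulus[of 0 "curve_part x"] \<open>curve_part x mod modulus = 0\<close> by (simp add: cp)
  let ?y0 = "coeff (axis_part y) 0"
  have quad: "quad g (quad_part (y * x)) = ?y0 * quad g (quad_part x)" for g
    unfolding quad_def by (simp add: q0 v0 sum_distrib_left mult_ac)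
  have \<beta>: "\<beta> (y * x) k = 0" if "k < 3" for k
    using \<beta>0[OF that] by (simp add: \<beta>_def quad q0 flip: distrib_left)
  have \<alpha>: "\<alpha> (y * x) l = 0" if "l < a" for l
    using that by (simp add: \<alpha>_def \<beta> q0 v0)
  obtain r where r: "axis_part y = pCons ?y0 r" by (metis coeff_pCons_0 pCons_cases)
  have "curve_part (y * x) = axis_part y * axis_part x + smult (?y0 * ?E) (pCons 0 p)"
    using \<alpha> \<beta> by (simp add: curve_part_def quad)
  also have "\<dots> = axis_part y * (axis_part x + smult ?E (pCons 0 p)) - smult ?E r * modulus"
  proof -
    have "axis_part y * smult ?E (pCons 0 p) = smult (?y0 * ?E) (pCons 0 p) + smult ?E r * modulus"
      by (subst r) (simp add: modulus_def smult_add_right algebra_simps)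
    then show ?thesis by (simp add: algebra_simps)
  qed
  finally have "modulus dvd curve_part (y * x)"
    using dvd by (metis dvd_diff dvd_mult dvd_triv_right)
  then have "curve_part (y * x) mod modulus = 0" by simp
  then show ?thesis using \<alpha> \<beta> by (simp add: \<Lambda>\<^sub>J_def)
qed

lemma \<phi>_basis_elem:
  "\<phi> (basis_elem i) = (if i < a + 3 then gen i else Axis_Jet (monom 1 (i - (a + 3))) (\<lambda>_. 0) (\<lambda>_ _. 0))"
proof (cases "i < a + 3")
  case False
  have "\<phi> (Var (\<iota> (a + 3)) ^ k) = Axis_Jet (monom 1 k) (\<lambda>_. 0) (\<lambda>_ _. 0)" for k
    using \<phi>_Var[of "a + 3"] unfolding \<phi>_def by (simp add: jetalg.ev_power gen_def Jet_power X_power)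
  with False show ?thesis by (simp add: glued_basis_def)
qed (simp add: glued_basis_def \<phi>_Var)

lemma \<Lambda>\<^sub>J_curve:
  "\<Lambda>\<^sub>J (Axis_Jet q (\<lambda>_. 0) (\<lambda>_ _. 0)) i = (if i < a + 3 then 0 else coeff (q mod modulus) (i - (a + 3)))"
  by (simp add: \<Lambda>\<^sub>J_def \<alpha>_def \<beta>_def curve_part_def)

lemma \<Lambda>\<^sub>J_dual:
  assumes "j < a + m + 5"
  shows "\<Lambda>\<^sub>J (\<phi> (basis_elem j)) i = (if i = j then 1 else 0)"
proof -
  consider "j < a" | k where "j = a + k" "k < 3" | k where "j = a + 3 + k" "k < m + 2"
  proof -
    consider "j < a" | "a \<le> j" "j < a + 3" | "a + 3 \<le> j" by linarith
    then show ?thesis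
      by cases (use that(1) that(2)[of "j - a"] that(3)[of "j - (a + 3)"] assms in auto)
  qed
  then show ?thesis
  proof cases
    case 1
    then have \<beta>: "\<beta> (gen j) k = 0" for k by (simp add: \<beta>_def gen_def)
    have \<alpha>: "\<alpha> (gen j) l = (if l = j then 1 else 0)" for l using 1 by (simp add: \<alpha>_def \<beta>) (simp add: gen_def)
    have "(\<Sum>l<a. smult (\<alpha> (gen j) l) (h l)) = h j"
      using 1 by (simp add: \<alpha> if_distrib[of "\<lambda>x. smult x _"] cong: if_cong)
    then have "curve_part (gen j) = 0"
      using 1 by (simp add: curve_part_def \<beta>) (simp add: gen_def)
    then show ?thesis using 1 by (simp add: \<phi>_basis_elem \<Lambda>\<^sub>J_def \<alpha> \<beta>)
  next
    case (2 k)
    then have \<beta>: "\<beta> (gen (a + k)) k' = (if k' = k then 1 else 0)" for k'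
      by (simp add: \<beta>_def gen_def)
    have \<alpha>: "\<alpha> (gen (a + k)) l = 0" if "l < a" for l
      using 2 that by (simp add: \<alpha>_def \<beta> if_distrib[of "\<lambda>x. x * _"] cong: if_cong) (simp add: gen_def)
    have "(\<Sum>k'<3. smult (\<beta> (gen (a + k)) k') (h (a + k'))) = h (a + k)"
      using 2 by (simp add: \<beta> if_distrib[of "\<lambda>x. smult x _"] cong: if_cong)
    then have "curve_part (gen (a + k)) = 0"
      using 2 by (simp add: curve_part_def \<alpha>) (simp add: gen_def)
    then show ?thesis using 2 by (auto simp: \<phi>_basis_elem \<Lambda>\<^sub>J_def \<alpha> \<beta>)
  next
    case (3 k)
    have "monom 1 k mod modulus = monom 1 k"
      using 3 degree_modulus by (intro mod_poly_less) (simp add: degree_monom_eq)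
    then show ?thesis using 3 by (auto simp: \<phi>_basis_elem \<Lambda>\<^sub>J_curve)
  qed
qed

lemma member_basis: "ideal_with_basis member (a + m + 5) basis_elem"
  and member_coord: "i < a + m + 5 \<Longrightarrow> coord member (a + m + 5) basis_elem f i = \<Lambda>\<^sub>J (\<phi> f) i"
  unfolding member_def
  by (rule ideal_with_basis_kernel;
      simp add: \<phi>_def jetalg.ev_add jetalg.ev_mult jetalg.ev_const \<Lambda>\<^sub>J_add \<Lambda>\<^sub>J_scale \<Lambda>\<^sub>J_mult
        \<Lambda>\<^sub>J_dual[unfolded \<phi>_def])+

text \<open>The remaining lemmas on the family read off its parameters from coordinates.\<close>

lemma coord_curve_times_var:
  assumes "i < a + 3" "j < m"
  shows "coord member (a + m + 5) basis_elem (Var (\<iota> (a + 3)) * Var (\<iota> i)) (a + j + 5) = coeff (h i) j"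
proof -
  have "\<phi> (Var (\<iota> (a + 3)) * Var (\<iota> i)) = gen (a + 3) * gen i"
    using \<phi>_Var[of i] \<phi>_Var[of "a + 3"] assms(1) by (simp add: \<phi>_def jetalg.ev_mult)
  also have "\<dots> = Axis_Jet (pCons 0 (pCons 0 (h i))) (\<lambda>_. 0) (\<lambda>_ _. 0)"
    using assms(1) by (auto simp: gen_def times_axis_jet_def)
  finally have \<phi>: "\<phi> (Var (\<iota> (a + 3)) * Var (\<iota> i)) = \<dots>" .
  have "degree (h i) < m"
    using h assms(2) by (metis degree_0 gr_implies_not0 leading_coeff_0_iff linorder_not_le zero_less_iff_neq_zero)
  then have "degree (pCons 0 (pCons 0 (h i))) < degree modulus"
    by (simp add: degree_modulus degree_pCons_eq_if)
  then have "pCons 0 (pCons 0 (h i)) mod modulus = pCons 0 (pCons 0 (h i))"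
    by (rule mod_poly_less)
  moreover have "a + j + 5 - (a + 3) = Suc (Suc j)" by simp
  ultimately show ?thesis using assms by (simp add: member_coord \<phi> \<Lambda>\<^sub>J_curve)
qed

lemma coord_curve_power:
  assumes "j < m"
  shows "coord member (a + m + 5) basis_elem (Var (\<iota> (a + 3)) ^ (m + 2)) (a + j + 5) = - coeff p j"
proof -
  have \<phi>: "\<phi> (Var (\<iota> (a + 3)) ^ (m + 2)) = Axis_Jet (monom 1 (m + 2)) (\<lambda>_. 0) (\<lambda>_ _. 0)"
    using \<phi>_basis_elem[of "a + 3 + (m + 2)"] by (simp add: glued_basis_def)
  have "monom 1 (m + 2) mod modulus = (monom 1 (m + 2) - modulus) mod modulus"
    by (simp add: poly_mod_diff_left)
  also have "\<dots> = monom 1 (m + 2) - modulus"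
  proof (cases "monom 1 (m + 2) - modulus = 0")
    case False
    have "degree (monom 1 (m + 2) - modulus) < m + 2"
    proof (rule degree_lessI, safe)
      fix i assume "i \<ge> m + 2"
      then obtain i' where i': "i = Suc (Suc i')" "i' \<ge> m" by (metis Suc_le_D add_2_eq_Suc' Suc_le_mono)
      show "coeff (monom 1 (m + 2) - modulus) i = 0"
        using i' p coeff_eq_0[of p i'] by (cases "i' = m") (auto simp: modulus_def)
    qed (use False in simp)
    then show ?thesis by (intro mod_poly_less) (simp add: degree_modulus)
  qed simp
  finally have "coeff (monom 1 (m + 2) mod modulus) (Suc (Suc j)) = - coeff p j"
    using assms by (simp add: modulus_def)
  moreover have "a + j + 5 - (a + 3) = Suc (Suc j)" by simp
  moreover have "a + j + 5 < a + m + 5" using assms by simp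
  ultimately show ?thesis by (simp only: member_coord \<phi> \<Lambda>\<^sub>J_curve) simp
qed

context
  fixes i j :: nat
  assumes i: "i < a" and j: "j < a"
begin

lemma \<phi>_product:
  "\<phi> (Var (\<iota> i) * Var (\<iota> j)) = Axis_Jet (pCons 0 (pCons 0 (h i * h j))) (\<lambda>_. 0)
     (\<lambda>k l. (if k = i \<and> l = j then 1 else 0) + (if k = j \<and> l = i then 1 else 0))"
proof -
  have "\<phi> (Var (\<iota> i) * Var (\<iota> j)) = gen i * gen j"
    using \<phi>_Var[of i] \<phi>_Var[of j] i j by (simp add: \<phi>_def jetalg.ev_mult)
  then show ?thesis using i j by (auto simp: gen_def times_axis_jet_def fun_eq_iff)
qed

lemma quad_product:
  assumes "g i j = g j i"
  shows "quad g (quad_part (\<phi> (Var (\<iota> i) * Var (\<iota> j)))) = g i j"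
proof -
  have pick: "(\<Sum>k<a. \<Sum>l<a. g k l * (if k = i' \<and> l = j' then 1 else 0)) = g i' j'"
    if "i' < a" "j' < a" for i' j'
  proof -
    have "(\<Sum>l<a. g k l * (if k = i' \<and> l = j' then 1 else 0)) = (if k = i' then g i' j' else 0)" for k
      using that by (cases "k = i'") (auto simp: if_distrib[of "\<lambda>x. _ * x"] cong: if_cong)
    then show ?thesis using that by simp
  qed
  show ?thesis
    using pick[OF i j] pick[OF j i] assms by (simp add: \<phi>_product quad_def distrib_left sum.distrib)
qed

lemma \<beta>_product: "\<beta> (\<phi> (Var (\<iota> i) * Var (\<iota> j))) k = c k i j"
  using quad_product[of "c k"] c_sym by (simp add: \<beta>_def \<phi>_product)

lemma \<alpha>_product: "\<alpha> (\<phi> (Var (\<iota> i) * Var (\<iota> j))) l = - (\<Sum>k<3. c k i j * t k l)"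
  unfolding \<alpha>_def \<beta>_product by (simp add: \<phi>_product)

lemma coord_product_socle:
  "k < 3 \<Longrightarrow> coord member (a + m + 5) basis_elem (Var (\<iota> i) * Var (\<iota> j)) (a + k) = c k i j"
  by (simp add: member_coord \<Lambda>\<^sub>J_def \<beta>_product)

lemma coord_product_shift:
  "l < a \<Longrightarrow> coord member (a + m + 5) basis_elem (Var (\<iota> i) * Var (\<iota> j)) l = - (\<Sum>k<3. c k i j * t k l)"
  by (simp add: member_coord \<Lambda>\<^sub>J_def \<alpha>_product)

lemma coord_product_curve:
  "coord member (a + m + 5) basis_elem (Var (\<iota> i) * Var (\<iota> j)) (a + 4) =
     e i j * coeff p 0 + (\<Sum>l<a. (\<Sum>k<3. c k i j * t k l) * coeff (h l) 0)
       - (\<Sum>k<3. c k i j * coeff (h (a + k)) 0)"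
proof -
  let ?T = "\<phi> (Var (\<iota> i) * Var (\<iota> j))"
  have "coord member (a + m + 5) basis_elem (Var (\<iota> i) * Var (\<iota> j)) (a + 4) = coeff (curve_part ?T) 1"
    using coeff_mod_modulus[of 1 "curve_part ?T"] by (simp add: member_coord \<Lambda>\<^sub>J_def)
  also have "\<dots> = e i j * coeff p 0 + (\<Sum>l<a. (\<Sum>k<3. c k i j * t k l) * coeff (h l) 0)
       - (\<Sum>k<3. c k i j * coeff (h (a + k)) 0)"
    unfolding curve_part_def quad_product[OF e_sym] \<alpha>_product \<beta>_product
    by (simp add: \<phi>_product coeff_sum sum_negf)
  finally show ?thesis .
qed

end

end

section \<open>Independent coordinates on the family\<close>

text \<open>
  Names for coefficient functions on the chart of \<open>glued_basis\<close>: each stands for the coefficient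
  of the polynomial \<open>coord_elem\<close> at the basis element with index \<open>coord_pos\<close>. In this order they
  detect the parameters \<open>h\<close>, \<open>p\<close>, \<open>c\<close>, \<open>e\<close> and \<open>t\<close> of the family.
\<close>

datatype coord_index = Curve nat nat | Power nat | Socle nat nat nat | Tail nat nat | Shift nat nat

fun coord_elem :: "nat \<Rightarrow> nat \<Rightarrow> (nat \<Rightarrow> 'v) \<Rightarrow> coord_index \<Rightarrow> 'v mpoly" where
  "coord_elem a m \<iota> (Curve i j) = Var (\<iota> (a + 3)) * Var (\<iota> i)"
| "coord_elem a m \<iota> (Power j) = Var (\<iota> (a + 3)) ^ (m + 2)"
| "coord_elem a m \<iota> (Socle i j k) = Var (\<iota> i) * Var (\<iota> j)"
| "coord_elem a m \<iota> (Tail i j) = Var (\<iota> i) * Var (\<iota> j)"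
| "coord_elem a m \<iota> (Shift k l) = Var (\<iota> k) * Var (\<iota> k)"

fun coord_pos :: "nat \<Rightarrow> coord_index \<Rightarrow> nat" where
  "coord_pos a (Curve i j) = a + j + 5"
| "coord_pos a (Power j) = a + j + 5"
| "coord_pos a (Socle i j k) = a + k"
| "coord_pos a (Tail i j) = a + 4"
| "coord_pos a (Shift k l) = l"

definition pairs :: "nat \<Rightarrow> (nat \<times> nat) set" where
  "pairs a = (SIGMA j:{..<a}. {..j})"

text \<open>
  The coefficient functions that remain free once the family is normalised by \<open>p(0) = 1\<close> and by \<open>\<xi>\<^sub>k * \<xi>\<^sub>k \<equiv> \<upsilon>\<^sub>k\<close> modulo \<open>z\<close> for \<open>k < 3\<close>. This removes the index
  \<open>0\<close> of \<open>Power\<close> and the three diagonal pairs of \<open>Socle\<close>.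
\<close>

definition coord_indices :: "nat \<Rightarrow> nat \<Rightarrow> coord_index set" where
  "coord_indices a m =
     (\<lambda>(i, j). Curve i j) ` ({..<a + 3} \<times> {..<m}) \<union> Power ` {1..<m} \<union>
     (\<lambda>((j, i), k). Socle i j k) ` ((pairs a - (\<lambda>i. (i, i)) ` {..<3}) \<times> {..<3}) \<union>
     (\<lambda>(j, i). Tail i j) ` pairs a \<union> (\<lambda>(k, l). Shift k l) ` ({..<3} \<times> {..<a})"

lemma finite_coord_indices: "finite (coord_indices a m)"
  by (simp add: coord_indices_def pairs_def)

lemma coord_pos_less: "x \<in> coord_indices a m \<Longrightarrow> coord_pos a x < a + m + 5"
  by (auto simp: coord_indices_def)

lemma card_pairs: "2 * card (pairs a) = a * (a + 1)"
proof -
  have "card (pairs a) = (\<Sum>j<a. Suc j)"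
    unfolding pairs_def by (simp add: card_SigmaI)
  moreover have "2 * (\<Sum>j<a. Suc j) = a * (a + 1)" by (induction a) auto
  ultimately show ?thesis by (simp only:)
qed

text \<open>
  With \<open>d = a + 4\<close> and \<open>n = a + m + 5\<close> the difference of the two sides is at least
  \<open>d\<^sup>2 - 12 d + 2\<close>, which is positive for \<open>d \<ge> 12\<close>.
\<close>

lemma card_coord_indices:
  assumes "a \<ge> 8"
  shows "(a + m + 5) * (a + 4) < card (coord_indices a m)"
proof -
  have fin: "finite (pairs a)" by (simp add: pairs_def)
  have sub: "(\<lambda>i. (i, i)) ` {..<3} \<subseteq> pairs a" using assms by (auto simp: pairs_def)
  have card_diag: "card ((\<lambda>i. (i, i)) ` {..<3::nat}) = 3" by (subst card_image) (auto simp: inj_on_def)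
  let ?A = "(\<lambda>(i, j). Curve i j) ` ({..<a + 3} \<times> {..<m})"
  let ?B = "Power ` {1..<m}"
  let ?C = "(\<lambda>((j, i), k). Socle i j k) ` ((pairs a - (\<lambda>i. (i, i)) ` {..<3}) \<times> {..<3})"
  let ?D = "(\<lambda>(j, i). Tail i j) ` pairs a"
  let ?E = "(\<lambda>(k, l). Shift k l) ` ({..<3} \<times> {..<a})"
  have A: "card ?A = (a + 3) * m" by (subst card_image) (auto simp: inj_on_def)
  have B: "card ?B = m - 1" by (subst card_image) (auto simp: inj_on_def)
  have C: "card ?C = (card (pairs a) - 3) * 3"
    using fin sub card_diag by (subst card_image) (auto simp: inj_on_def card_Diff_subset card_cartesian_product)
  have D: "card ?D = card (pairs a)" by (subst card_image) (auto simp: inj_on_def)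
  have E: "card ?E = 3 * a" by (subst card_image) (auto simp: inj_on_def)
  have "card (coord_indices a m) = card ?A + card ?B + card ?C + card ?D + card ?E"
    unfolding coord_indices_def using fin
    by (subst card_Un_disjoint; (auto; fail)?)+
  then have 1: "card (coord_indices a m) =
      (a + 3) * m + (m - 1) + (card (pairs a) - 3) * 3 + card (pairs a) + 3 * a"
    by (simp only: A B C D E)
  have "card (pairs a) \<ge> 3" using card_mono[OF fin sub] card_diag by simp
  then have 2: "(card (pairs a) - 3) * 3 + card (pairs a) + 9 = 2 * (a * (a + 1))"
    using card_pairs[of a] by simp
  obtain r where r: "a = r + 8" using assms by (metis add.commute le_Suc_ex)
  have "(a + m + 5) * (a + 4) + 10 < (a + 3) * m + m + 2 * (a * (a + 1)) + 3 * a"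
    unfolding r by (simp add: algebra_simps)
  then show ?thesis using 1 2 by linarith
qed

text \<open>
  The normalisation makes the system for the parameters triangular. The coordinates \<open>Curve\<close>,
  \<open>Power\<close> and \<open>Socle\<close> are the parameters \<open>h\<close>, \<open>- p\<close> and \<open>c\<close> themselves; as \<open>\<xi>\<^sub>k * \<xi>\<^sub>k\<close> is
  \<open>\<upsilon>\<^sub>k\<close> up to the curve, \<open>Shift\<close> is \<open>- t\<close>; and \<open>Tail\<close> is \<open>e\<close>, since \<open>p(0) = 1\<close>, up to an
  expression in the others.
\<close>

lemma family_attains:
  fixes \<iota> :: "nat \<Rightarrow> 'v::finite" and \<tau> :: "coord_index \<Rightarrow> complex"
  assumes \<iota>: "inj_on \<iota> {..<a + 4}" and a: "a \<ge> 3"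
  obtains I where "ideal_with_basis I (a + m + 5) (glued_basis a \<iota>)"
    "\<And>x. x \<in> coord_indices a m \<Longrightarrow>
       coord I (a + m + 5) (glued_basis a \<iota>) (coord_elem a m \<iota> x) (coord_pos a x) = \<tau> x"
proof -
  define h where "h i = (\<Sum>j<m. monom (\<tau> (Curve i j)) j)" for i
  define p where "p = monom 1 m + (\<Sum>j<m. monom (if j = 0 then 1 else - \<tau> (Power j)) j)"
  define t where "t k l = - \<tau> (Shift k l)" for k l
  define c where "c k i j = (if i = j \<and> i < 3 then if k = i then 1 else 0
      else \<tau> (Socle (min i j) (max i j) k))" for k i j
  define e where "e i j = \<tau> (Tail (min i j) (max i j)) - (\<Sum>l<a. (\<Sum>k<3. c k i j * t k l) * coeff (h l) 0)
      + (\<Sum>k<3. c k i j * coeff (h (a + k)) 0)" for i j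
  have coeff_h: "coeff (h i) j = (if j < m then \<tau> (Curve i j) else 0)" for i j
    by (simp add: h_def coeff_sum)
  have coeff_p: "coeff p j = (if j = m then 1 else if j < m then if j = 0 then 1 else - \<tau> (Power j) else 0)" for j
    by (auto simp: p_def coeff_sum)
  have deg_p: "degree p = m"
    by (intro antisym degree_le le_degree) (auto simp: coeff_p)
  have c_sym: "c k i j = c k j i" for k i j
    by (auto simp: c_def min.commute max.commute)
  interpret glued_family a m \<iota> p h t c e
  proof
    show "e i j = e j i" for i j
      unfolding e_def by (simp add: c_sym[of _ i j] min.commute max.commute)
  qed (use \<iota> deg_p c_sym in \<open>auto simp: coeff_h coeff_p\<close>)
  have p0: "coeff p 0 = 1" by (simp add: coeff_p)
  show ?thesis
  proof (rule that[OF member_basis])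
    fix x assume "x \<in> coord_indices a m"
    then consider i j where "x = Curve i j" "i < a + 3" "j < m"
      | j where "x = Power j" "1 \<le> j" "j < m"
      | i j k where "x = Socle i j k" "i \<le> j" "j < a" "k < 3" "(j, i) \<notin> (\<lambda>i. (i, i)) ` {..<3}"
      | i j where "x = Tail i j" "i \<le> j" "j < a"
      | k l where "x = Shift k l" "k < 3" "l < a"
      by (auto simp: coord_indices_def pairs_def)
    then show "coord member (a + m + 5) basis_elem (coord_elem a m \<iota> x) (coord_pos a x) = \<tau> x"
    proof cases
      case 1
      then show ?thesis by (simp add: coord_curve_times_var coeff_h)
    next
      case 2
      then show ?thesis using coord_curve_power[of j] by (simp add: coeff_p)
    next
      case 3
      then have "\<not> (i = j \<and> i < 3)" by blast
      with 3 show ?thesis by (auto simp: coord_product_socle c_def min_def max_def)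
    next
      case 4
      then show ?thesis by (simp add: coord_product_curve p0 e_def min_def max_def)
    next
      case 5
      have "(\<Sum>k'<3. c k' k k * t k' l) = t k l"
        using 5 by (simp add: c_def if_distrib[of "\<lambda>x. x * _"] cong: if_cong)
      then show ?thesis using 5 a by (simp add: coord_product_shift t_def)
    qed
  qed
qed

section \<open>Two disjoint open sets\<close>

lemma polyfun_cong: "polyfun S f \<Longrightarrow> (\<And>i. i \<in> S \<Longrightarrow> x i = y i) \<Longrightarrow> f x = f y"
  by (induction rule: polyfun.induct) auto

lemma not_irreducible_if_disjoint_opens:
  assumes "openin X U" "openin X V" "U \<noteq> {}" "V \<noteq> {}" "U \<inter> V = {}"
  shows "\<not> irreducible_space X"
proof
  assume irr: "irreducible_space X"
  have "U \<subseteq> topspace X" "V \<subseteq> topspace X" using assms by (auto dest: openin_subset)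
  moreover have "closedin X (topspace X - U)" "closedin X (topspace X - V)" using assms by auto
  moreover have "topspace X = (topspace X - U) \<union> (topspace X - V)" using assms by auto
  ultimately have "topspace X - U = topspace X \<or> topspace X - V = topspace X"
    using irr unfolding irreducible_space_def by metis
  then show False using \<open>U \<subseteq> _\<close> \<open>V \<subseteq> _\<close> assms by blast
qed

lemma openin_Hilb: "openin (Hilb n) (hilb_basic_open n B F)"
  unfolding Hilb_def by (rule topology_generated_by_Basis) blast

theorem theorem1:
  fixes n d :: nat
  assumes "CARD('d::finite) = d"
    and "n > d" and "d \<ge> 12"
  shows "\<not> irreducible_space (Hilb n :: 'd mpoly set topology)"
proof -
  define a where "a = d - 4"
  define m where "m = n - d - 1"
  have a: "a \<ge> 8" "d = a + 4" and n: "n = a + m + 5" using assms by (auto simp: a_def m_def)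
  \<comment> \<open>\<open>a\<close> variables generate the local algebra, three more and \<open>z\<close> give its socle;
    \<open>m\<close> is the number of further points\<close>
  obtain \<iota> :: "nat \<Rightarrow> 'd" where "bij_betw \<iota> {..<a + 4} UNIV"
    using ex_bij_betw_nat_finite[of "UNIV :: 'd set"] assms(1) a by (auto simp: atLeast0LessThan)
  then have \<iota>: "inj_on \<iota> {..<a + 4}" by (simp add: bij_betw_def)
  interpret cyclic_chart n "\<iota> 0" by unfold_locales (simp add: n)
  let ?b = "glued_basis a \<iota>"
  let ?J = "coord_indices a m"
  let ?f = "coord_elem a m \<iota>" and ?i = "coord_pos a"
  obtain D where D: "polyfun params D"
      "\<And>I. cyclic I \<Longrightarrow> ideal_with_basis I n ?b \<Longrightarrow> D (param I) \<noteq> 0"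
      "\<And>f i. i < n \<Longrightarrow> \<exists>P. polyfun params P \<and> (\<forall>I. cyclic I \<longrightarrow> ideal_with_basis I n ?b \<longrightarrow>
        D (param I) * coord I n ?b f i = P (param I))"
    by (rule coords_rational[of ?b]) blast
  have "\<forall>x\<in>?J. \<exists>P. polyfun params P \<and> (\<forall>I. cyclic I \<longrightarrow> ideal_with_basis I n ?b \<longrightarrow>
        D (param I) * coord I n ?b (?f x) (?i x) = P (param I))"
    using D(3) coord_pos_less n by blast
  then obtain P where P: "\<And>x. x \<in> ?J \<Longrightarrow> polyfun params (P x)"
      "\<And>x I. x \<in> ?J \<Longrightarrow> cyclic I \<Longrightarrow> ideal_with_basis I n ?b \<Longrightarrow>
        D (param I) * coord I n ?b (?f x) (?i x) = P x (param I)"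
    by metis
  have "card params < card ?J"
    using card_coord_indices[OF a(1), of m] assms(1) a(2) n by (simp add: card_cartesian_product mult.commute)
  then have "\<exists>F. polyfun ?J F \<and> (\<exists>x. F x \<noteq> 0) \<and>
      (\<forall>\<theta> y. D \<theta> \<noteq> 0 \<longrightarrow> (\<forall>x\<in>?J. D \<theta> * y x = P x \<theta>) \<longrightarrow> F y = 0)"
    using algebraic_dependence[where S = params and J = ?J and P = P and D = D] P(1) D(1)
      finite_coord_indices[of a m] by simp
  then obtain F x\<^sub>0 where F: "polyfun ?J F" "F x\<^sub>0 \<noteq> 0"
      "\<And>\<theta> y. D \<theta> \<noteq> 0 \<Longrightarrow> \<forall>x\<in>?J. D \<theta> * y x = P x \<theta> \<Longrightarrow> F y = 0"
    by blast
  obtain G where G: "\<And>y. eval_mpoly y G = F (\<lambda>x. y (?f x, ?b (?i x)))"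
    using polyfun_eval_mpoly[OF F(1), of "\<lambda>x. (?f x, ?b (?i x))"] by blast
  have G': "eval_mpoly (\<lambda>(f, b). coeff_mod I (?b ` {..<n}) f b) G = F (\<lambda>x. coord I n ?b (?f x) (?i x))" for I
    by (simp add: G coord_def)
  \<comment> \<open>where both bases exist, \<open>F\<close> vanishes on the chosen coordinates of the ideals in \<open>U\<close>, but not on
    those of the ideals in \<open>V\<close>\<close>
  define U where "U = hilb_basic_open n (pw ` {..<n}) 1"
  define V where "V = hilb_basic_open n (?b ` {..<n}) G"
  obtain I\<^sub>0 where I\<^sub>0: "cyclic I\<^sub>0" using cyclic_exists by blast
  obtain I\<^sub>1 where I\<^sub>1: "ideal_with_basis I\<^sub>1 n ?b"
      "\<And>x. x \<in> ?J \<Longrightarrow> coord I\<^sub>1 n ?b (?f x) (?i x) = x\<^sub>0 x"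
    using family_attains[OF \<iota>, of m x\<^sub>0] a(1) n by auto
  have inj: "inj_on pw {..<n}" "inj_on ?b {..<n}"
    using I\<^sub>0 I\<^sub>1(1) by (auto simp: ideal_with_basis_def)
  have U: "I \<in> U \<longleftrightarrow> cyclic I" for I
    using inj(1) by (auto simp: U_def hilb_basic_open_def ideal_with_basis_def card_image eval_mpoly_eq)
  have V: "I \<in> V \<longleftrightarrow> ideal_with_basis I n ?b \<and> F (\<lambda>x. coord I n ?b (?f x) (?i x)) \<noteq> 0" for I
    using inj(2) by (auto simp: V_def hilb_basic_open_def ideal_with_basis_def card_image G')
  have "F (\<lambda>x. coord I\<^sub>1 n ?b (?f x) (?i x)) = F x\<^sub>0"
    by (rule polyfun_cong[OF F(1)]) (rule I\<^sub>1(2))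
  then have "I\<^sub>1 \<in> V" using I\<^sub>1(1) F(2) by (simp add: V)
  have "F (\<lambda>x. coord I n ?b (?f x) (?i x)) = 0" if "cyclic I" "ideal_with_basis I n ?b" for I
    using F(3)[OF D(2)[OF that]] P(2)[OF _ that] by simp
  then have "U \<inter> V = {}" using U V by blast
  show ?thesis
  proof (rule not_irreducible_if_disjoint_opens)
    show "openin (Hilb n) U" "openin (Hilb n) V" by (simp_all add: U_def V_def openin_Hilb)
    show "U \<noteq> {}" "V \<noteq> {}" using I\<^sub>0 U \<open>I\<^sub>1 \<in> V\<close> by blast+
  qed fact
qed

end
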